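(* Let $L\ge 1$ be an integer, and for $i\in\{1,2,3,4\}$ let $R_i(L)$ be the set of $R_i$ paths of length $2L$ with weights $W^{(i)}(p)$ as defined in the context. Let $Z_L = W(DE)^L V$ be the normalisation of the two-parameter asymmetric simple exclusion process (also defined in the context). Then $$Z_L=\sum_{p\in R_1(L)} W^{(1)}(p),\qquad Z_L=\sum_{p\in R_2(L)} W^{(2)}(p),$$ $$Z_L=\sum_{p\in R_3(L)} W^{(3)}(p),\qquad Z_L=\sum_{p\in R_4(L)} W^{(4)}(p).$$ The sum over $R_2(L)$ is infinite and the identity is understood in the ring $\mathbb{Q}[[c,d]]$ of formal power series in $c,d$; the other three sums are finite.
   Context: **Parameters.** Let $c,d$ be indeterminates and work in $K=\mathbb{Q}[[c,d]]$. Put $\bar\alpha=1+c$, $\bar\beta=1+d$ (in the exclusion process with entry probability $\alpha$ and exit probability $\beta$, $\bar\alpha=1/\alpha$ and $\bar\beta=1/\beta$), and let $\kappa\in K$ be the square root with constant term $1$ of $\kappa^2=1-cd=\bar\alpha+\bar\beta-\bar\alpha\bar\beta$. **Normalisation $Z_L$.** Matrices $D,E$, a row vector $W$ and a column vector $V$ satisfy the DEHP algebra if $DE=D+E$, $WE=\bar\alpha W$, $DV=\bar\beta V$; they are normalised by $WV=1$. Then $Z_L=W(DE)^LV=W(D+E)^LV$; its value depends only on these relations. Equivalently: let $A$ be the unital associative $K$-algebra generated by $D,E$ with the single relation $DE=D+E$, and let $\varphi:A\to K$ be the $K$-linear functional (corresponding to $X\mapsto WXV$) determined by $\varphi(1)=1$,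 $\varphi(EX)=\bar\alpha\,\varphi(X)$ and $\varphi(XD)=\bar\beta\,\varphi(X)$ for all $X\in A$; then $Z_L=\varphi((DE)^L)$. **Lattice paths.** All paths are sequences of vertices $v_0v_1\cdots v_{2L}$ in $\mathbb{Z}\times\mathbb{N}_0$ (with $\mathbb{N}_0=\{0,1,2,\dots\}$); the $i$-th step is $e_i=(v_{i-1},v_i)$, $1\le i\le 2L$, and $v_i-v_{i-1}$ must lie in the $i$-th step set. The height of $(x,y)$ is $y$. The weight $W^{(i)}(p)$ of a path is the product of the weight of its initial vertex, the weight of its final vertex, and the weights of all its steps. * **$R_1$ paths.** Step sets: $\{(1,-1)\}$ for $i$ even; $\{(1,2k-1): k\in\mathbb{N}_0\}$ for $i$ odd. $v_0=(0,2k+1)$ for some $k\in\mathbb{N}_0$, $v_{2L}=(2L,1)$. Weights: $v_0=(0,2k+1)$ has weight $\bar\alpha^k$; $v_{2L}$ has weight $1$; a step $e_i$ with $i$ odd from $(i-1,1)$ to $(i,2k'+2)$, $k'\in\mathbb{N}_0$, has weight $\bar\beta$; all other steps have weight $1$. * **$R_2$ paths.** Step sets $\{(1,-1),(1,1)\}$ for all $i$. $v_0=(0,2k+1)$ and $v_{2L}=(2L,2k'+1)$ for some $k,k'\in\mathbb{N}_0$. Weights: $v_0$ has weight $\kappa c^k$, $v_{2L}$ has weight $\kappa d^{k'}$, all steps have weight $1$. * **$R_3$ paths.** Step sets $\{(1,-1),(1,1)\}$ for all $i$. $v_0=(0,1)$, $v_{2L}=(2L,1)$, both of weight $1$. Step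 weights: $\kappa$ for a step from height $1$ to height $2$ or from height $2$ to height $1$; $\bar\beta$ for a step from height $1$ to height $0$; $\bar\alpha$ for a step from height $0$ to height $1$; $1$ otherwise. * **$R_4$ paths.** Step sets $\{(1,-1),(1,1)\}$ for all $i$. $v_0=(0,1)$, $v_{2L}=(2L,1)$, all vertices have height greater than zero, and exactly one of the height-one vertices is marked (so an $R_4$ path is a pair consisting of a path and a choice of one of its height-one vertices, where $v_0$ and $v_{2L}$ are allowed choices). The initial and final vertices have weight $1$. If the marked vertex is $v_k$, the step $e_i$ has weight $\bar\alpha$ if it goes from height $2$ to height $1$ and $i\le k$; weight $\bar\beta$ if it goes from height $1$ to height $2$ and $i>k$; weight $1$ otherwise. *)

theory Defs
  imports
    "HOL-Computational_Algebra.Formal_Power_Series"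
    "HOL-Library.Poly_Mapping"
begin

section \<open>The coefficient ring\<close>

text \<open>
  The ring of formal power series in two indeterminates \<open>c\<close>, \<open>d\<close> over the rationals is represented
  as the ring of power series in \<open>d\<close> whose coefficients are power series in \<open>c\<close>.
\<close>

type_synonym K = "rat fps fps"

definition c :: K where
  "c = fps_const fps_X"

definition d :: K where
  "d = fps_X"

text \<open>The coefficient of \<open>c\<^sup>i d\<^sup>j\<close>; the outer variable is \<open>d\<close>.\<close>

definition coeff_cd :: "K \<Rightarrow> nat \<Rightarrow> nat \<Rightarrow> rat" where
  "coeff_cd f i j = fps_nth (fps_nth f j) i"

definition abar :: K where
  "abar = 1 + c"

definition bbar :: K where
  "bbar = 1 + d"

definition kappa :: K where
  "kappa = (THE k. k\<^sup>2 = 1 - c * d \<and> coeff_cd k 0 0 = 1)"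

text \<open>
  Unordered summation of a possibly infinite family in the \<open>(c, d)\<close>-adic topology: every monomial
  occurs in only finitely many members, and the coefficients add up. The topology that the library
  puts on \<^typ>\<open>rat fps fps\<close> is the \<open>d\<close>-adic one, in which for instance the powers of \<open>c\<close>
  are not summable, so the notions of convergence based on it cannot be used here.
\<close>

definition fps_sums_on :: "('a \<Rightarrow> K) \<Rightarrow> 'a set \<Rightarrow> K \<Rightarrow> bool" where
  "fps_sums_on f A s \<longleftrightarrow>
     (\<forall>i j. finite {a \<in> A. coeff_cd (f a) i j \<noteq> 0} \<and>
            coeff_cd s i j = (\<Sum>a | a \<in> A \<and> coeff_cd (f a) i j \<noteq> 0. coeff_cd (f a) i j))"


section \<open>The DEHP algebra and the normalisation\<close>

datatype letter = LetD | LetE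

text \<open>
  Words under concatenation, written additively so that finitely supported functions from words to
  \<^typ>\<open>K\<close> with the convolution product of \<^theory>\<open>HOL-Library.Poly_Mapping\<close>
  form the free algebra.
\<close>

datatype word = Word (letters: "letter list")

instantiation word :: monoid_add
begin

definition zero_word :: word where
  "zero_word = Word []"

definition plus_word :: "word \<Rightarrow> word \<Rightarrow> word" where
  "plus_word u v = Word (letters u @ letters v)"

instance
  by standard (simp_all add: zero_word_def plus_word_def)

end

type_synonym free_alg = "word \<Rightarrow>\<^sub>0 K"

definition free_D :: free_alg where
  "free_D = Poly_Mapping.single (Word [LetD]) 1"

definition free_E :: free_alg where
  "free_E = Poly_Mapping.single (Word [LetE]) 1"

inductive_set dehp_ideal :: "free_alg set" where
  gen: "free_D * free_E - (free_D + free_E) \<in> dehp_ideal"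
| zero: "0 \<in> dehp_ideal"
| add: "x \<in> dehp_ideal \<Longrightarrow> y \<in> dehp_ideal \<Longrightarrow> x + y \<in> dehp_ideal"
| left: "x \<in> dehp_ideal \<Longrightarrow> a * x \<in> dehp_ideal"
| right: "x \<in> dehp_ideal \<Longrightarrow> x * a \<in> dehp_ideal"

lemma dehp_ideal_uminus: "x \<in> dehp_ideal \<Longrightarrow> - x \<in> dehp_ideal"
  using dehp_ideal.left[of x "- 1"] by simp

lemma dehp_ideal_diff: "x \<in> dehp_ideal \<Longrightarrow> y \<in> dehp_ideal \<Longrightarrow> x - y \<in> dehp_ideal"
  using dehp_ideal.add[of x "- y"] dehp_ideal_uminus[of y] by simp

definition dehp_cong :: "free_alg \<Rightarrow> free_alg \<Rightarrow> bool" where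
  "dehp_cong x y \<longleftrightarrow> x - y \<in> dehp_ideal"

lemma equivp_dehp_cong: "equivp dehp_cong"
proof (rule equivpI)
  show "reflp dehp_cong"
    by (rule reflpI) (simp add: dehp_cong_def dehp_ideal.zero)
  show "symp dehp_cong"
  proof (rule sympI)
    fix x y assume "dehp_cong x y"
    then show "dehp_cong y x"
      using dehp_ideal_uminus[of "x - y"] by (simp add: dehp_cong_def)
  qed
  show "transp dehp_cong"
  proof (rule transpI)
    fix x y z assume "dehp_cong x y" "dehp_cong y z"
    then show "dehp_cong x z"
      using dehp_ideal.add[of "x - y" "y - z"] by (simp add: dehp_cong_def)
  qed
qed

quotient_type dehp_alg = free_alg / dehp_cong
  by (rule equivp_dehp_cong)

instantiation dehp_alg :: "{ring, monoid_mult}"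
begin

lift_definition zero_dehp_alg :: dehp_alg is 0 .

lift_definition one_dehp_alg :: dehp_alg is 1 .

lift_definition plus_dehp_alg :: "dehp_alg \<Rightarrow> dehp_alg \<Rightarrow> dehp_alg" is "(+)"
proof -
  fix x x' y y' assume "dehp_cong x x'" "dehp_cong y y'"
  then show "dehp_cong (x + y) (x' + y')"
    using dehp_ideal.add[of "x - x'" "y - y'"] by (simp add: dehp_cong_def algebra_simps)
qed

lift_definition uminus_dehp_alg :: "dehp_alg \<Rightarrow> dehp_alg" is uminus
proof -
  fix x x' assume "dehp_cong x x'"
  then show "dehp_cong (- x) (- x')"
    using dehp_ideal_uminus[of "x - x'"] by (simp add: dehp_cong_def algebra_simps)
qed

lift_definition minus_dehp_alg :: "dehp_alg \<Rightarrow> dehp_alg \<Rightarrow> dehp_alg" is "(-)"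
proof -
  fix x x' y y' assume "dehp_cong x x'" "dehp_cong y y'"
  then show "dehp_cong (x - y) (x' - y')"
    using dehp_ideal_diff[of "x - x'" "y - y'"] by (simp add: dehp_cong_def algebra_simps)
qed

lift_definition times_dehp_alg :: "dehp_alg \<Rightarrow> dehp_alg \<Rightarrow> dehp_alg" is "(*)"
proof -
  fix x x' y y' assume *: "dehp_cong x x'" "dehp_cong y y'"
  have "x * y - x' * y' = (x - x') * y + x' * (y - y')"
    by (simp add: algebra_simps)
  then show "dehp_cong (x * y) (x' * y')"
    using * by (simp add: dehp_cong_def dehp_ideal.intros)
qed

instance
  by standard (transfer, simp add: dehp_cong_def dehp_ideal.zero algebra_simps)+

end

lift_definition gen_D :: dehp_alg is free_D .

lift_definition gen_E :: dehp_alg is free_E .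

text \<open>The structure map of the algebra: scaling by \<open>k\<close> is multiplication by \<open>scalar k\<close>.\<close>

lift_definition scalar :: "K \<Rightarrow> dehp_alg" is "\<lambda>k. Poly_Mapping.single 0 k" .

definition K_linear :: "(dehp_alg \<Rightarrow> K) \<Rightarrow> bool" where
  "K_linear f \<longleftrightarrow>
     (\<forall>X Y. f (X + Y) = f X + f Y) \<and> (\<forall>k X. f (scalar k * X) = k * f X)"

definition is_dehp_functional :: "(dehp_alg \<Rightarrow> K) \<Rightarrow> bool" where
  "is_dehp_functional f \<longleftrightarrow>
     K_linear f \<and> f 1 = 1 \<and>
     (\<forall>X. f (gen_E * X) = abar * f X) \<and> (\<forall>X. f (X * gen_D) = bbar * f X)"

definition phi :: "dehp_alg \<Rightarrow> K" where
  "phi = (THE f. is_dehp_functional f)"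

definition Z :: "nat \<Rightarrow> K" where
  "Z L = phi ((gen_D * gen_E) ^ L)"


section \<open>Weighted lattice paths\<close>

type_synonym vertex = "int \<times> nat"

definition displacement :: "vertex \<Rightarrow> vertex \<Rightarrow> int \<times> int" where
  "displacement u v = (fst v - fst u, int (snd v) - int (snd u))"

text \<open>
  A path of length \<open>n\<close> is the list of its vertices \<open>v\<^sub>0, \<dots>, v\<^sub>n\<close>; the \<open>i\<close>-th step,
  \<open>1 \<le> i \<le> n\<close>, leads from \<open>v\<^sub>i\<^sub>-\<^sub>1\<close> to \<open>v\<^sub>i\<close>.
\<close>

definition paths ::
    "(nat \<Rightarrow> (int \<times> int) set) \<Rightarrow> vertex set \<Rightarrow> vertex set \<Rightarrow> nat \<Rightarrow> vertex list set" where
  "paths steps starts ends n =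
     {p. length p = n + 1 \<and> p ! 0 \<in> starts \<and> p ! n \<in> ends \<and>
         (\<forall>i\<in>{1..n}. displacement (p ! (i - 1)) (p ! i) \<in> steps i)}"

definition path_weight ::
    "(vertex \<Rightarrow> K) \<Rightarrow> (vertex \<Rightarrow> K) \<Rightarrow> (nat \<Rightarrow> vertex \<Rightarrow> vertex \<Rightarrow> K) \<Rightarrow> vertex list \<Rightarrow> K" where
  "path_weight w_start w_end w_step p =
     w_start (hd p) * w_end (last p) *
     (\<Prod>i\<in>{1..length p - 1}. w_step i (p ! (i - 1)) (p ! i))"

definition updown :: "nat \<Rightarrow> (int \<times> int) set" where
  "updown i = {(1, -1), (1, 1)}"

text \<open>
  Weights of initial and final vertices below are only relevant at odd heights;
  a vertex of height \<open>2k + 1\<close> has \<open>snd v div 2 = k\<close>.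
\<close>

definition R1 :: "nat \<Rightarrow> vertex list set" where
  "R1 L = paths
     (\<lambda>i. if even i then {(1, -1)} else {(1, 2 * int k - 1) | k :: nat. True})
     {(0, 2 * k + 1) | k. True} {(2 * int L, 1)} (2 * L)"

definition W1 :: "vertex list \<Rightarrow> K" where
  "W1 = path_weight (\<lambda>v. abar ^ (snd v div 2)) (\<lambda>v. 1)
     (\<lambda>i u v. if odd i \<and> u = (int i - 1, 1) \<and> (\<exists>k'. v = (int i, 2 * k' + 2)) then bbar else 1)"

definition R2 :: "nat \<Rightarrow> vertex list set" where
  "R2 L = paths updown {(0, 2 * k + 1) | k. True} {(2 * int L, 2 * k' + 1) | k'. True} (2 * L)"

definition W2 :: "vertex list \<Rightarrow> K" where
  "W2 = path_weight (\<lambda>v. kappa * c ^ (snd v div 2)) (\<lambda>v. kappa * d ^ (snd v div 2)) (\<lambda>i u v. 1)"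

definition R3 :: "nat \<Rightarrow> vertex list set" where
  "R3 L = paths updown {(0, 1)} {(2 * int L, 1)} (2 * L)"

definition W3 :: "vertex list \<Rightarrow> K" where
  "W3 = path_weight (\<lambda>v. 1) (\<lambda>v. 1)
     (\<lambda>i u v.
        if (snd u = 1 \<and> snd v = 2) \<or> (snd u = 2 \<and> snd v = 1) then kappa
        else if snd u = 1 \<and> snd v = 0 then bbar
        else if snd u = 0 \<and> snd v = 1 then abar
        else 1)"

text \<open>The second component is the index of the marked vertex.\<close>

definition R4 :: "nat \<Rightarrow> (vertex list \<times> nat) set" where
  "R4 L = {(p, k). p \<in> paths updown {(0, 1)} {(2 * int L, 1)} (2 * L) \<and>
     (\<forall>v\<in>set p. snd v > 0) \<and> k \<le> 2 * L \<and> snd (p ! k) = 1}"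

definition W4 :: "vertex list \<times> nat \<Rightarrow> K" where
  "W4 = (\<lambda>(p, k). path_weight (\<lambda>v. 1) (\<lambda>v. 1)
     (\<lambda>i u v.
        if snd u = 2 \<and> snd v = 1 \<and> i \<le> k then abar
        else if snd u = 1 \<and> snd v = 2 \<and> i > k then bbar
        else 1) p)"

end

theory Submission
  imports Defs
begin

text \<open>
  The rules for \<open>D\<close>, \<open>E\<close>, \<open>W\<close>, \<open>V\<close> determine the value of every word, so \<open>Z L\<close> is the value of
  \<open>(DE)\<^sup>L\<close> in any matrix representation. For \<open>R1\<close>, \<open>R2\<close> and \<open>R3\<close> there are representations in which
  \<open>D\<close> and \<open>E\<close> are the transfer matrices from odd to even and from even to odd heights, so that
  \<open>W (DE)\<^sup>L V\<close> is the weighted path count. The marked paths of \<open>R4\<close> are compared with \<open>R3\<close> instead: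
  with \<open>f n h\<close> and \<open>e n h\<close> the sums over suffixes of length \<open>n\<close> from height \<open>h + 1\<close> after and before
  the mark, one has \<open>f (n + 1) h = e (n + 1) h - abar * e n (h + 1)\<close>; together with
  \<open>kappa\<^sup>2 = abar + bbar - abar * bbar\<close> this shows that \<open>e\<close> satisfies the recursion of the \<open>R3\<close> suffixes.
\<close>

section \<open>The functional on words\<close>

text \<open>The arbitrary context \<open>u\<close>, \<open>v\<close> in the last clause is what
  makes the linear extension vanish on the whole two-sided ideal.\<close>

definition word_functional :: "(letter list \<Rightarrow> K) \<Rightarrow> bool" where
  "word_functional \<omega> \<longleftrightarrow>
     \<omega> [] = 1 \<and>
     (\<forall>w. \<omega> (LetE # w) = abar * \<omega> w) \<and>
     (\<forall>w. \<omega> (w @ [LetD]) = bbar * \<omega> w) \<and>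
     (\<forall>u v. \<omega> (u @ [LetD, LetE] @ v) = \<omega> (u @ [LetD] @ v) + \<omega> (u @ [LetE] @ v))"

text \<open>The factor sits where the initial run of \<open>LetD\<close> ends.\<close>

lemma ex_DE_factor:
  assumes "hd w = LetD" "last w = LetE" "w \<noteq> []"
  shows "\<exists>u v. w = u @ [LetD, LetE] @ v"
  using assms
proof (induction w)
  case (Cons l w)
  show ?case
  proof (cases w)
    case (Cons l' w')
    show ?thesis
    proof (cases l')
      case LetD
      then obtain u v where "w = u @ [LetD, LetE] @ v"
        using Cons Cons.IH Cons.prems by auto
      then have "l # w = (l # u) @ [LetD, LetE] @ v"
        by simp
      then show ?thesis
        by blast
    next
      case LetE
      then have "l # w = [] @ [LetD, LetE] @ w'"
        using Cons Cons.prems by simp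
      then show ?thesis
        by blast
    qed
  qed (use Cons.prems in auto)
qed simp

text \<open>
  A word that neither begins with \<open>E\<close> nor ends with \<open>D\<close> contains \<open>DE\<close>, so one of the rules always
  reduces to shorter words.
\<close>

lemma word_functional_unique:
  assumes "word_functional \<omega>" "word_functional \<omega>'"
  shows "\<omega> w = \<omega>' w"
proof (induction w rule: length_induct)
  case (1 w)
  consider "w = []" | "w \<noteq> []" "hd w = LetE" | "w \<noteq> []" "last w = LetD"
    | "w \<noteq> []" "hd w = LetD" "last w = LetE"
    by (metis letter.exhaust)
  then show ?case
  proof cases
    case 1
    then show ?thesis
      using assms by (simp add: word_functional_def)
  next
    case 2
    then obtain v where "w = LetE # v"
      by (metis list.collapse)
    then show ?thesis
      using assms 1 by (simp add: word_functional_def)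
  next
    case 3
    then obtain v where "w = v @ [LetD]"
      by (metis append_butlast_last_id)
    then show ?thesis
      using assms 1 by (simp add: word_functional_def)
  next
    case 4
    then obtain u v where "w = u @ [LetD, LetE] @ v"
      using ex_DE_factor by blast
    moreover have "\<omega> (u @ [l] @ v) = \<omega>' (u @ [l] @ v)" for l
      using 1 calculation by simp
    ultimately show ?thesis
      using assms unfolding word_functional_def by metis
  qed
qed

section \<open>Linear extension to the free algebra and descent to the quotient\<close>

definition lin_ext :: "(letter list \<Rightarrow> K) \<Rightarrow> free_alg \<Rightarrow> K" where
  "lin_ext \<omega> x = (\<Sum>w\<in>Poly_Mapping.keys x. Poly_Mapping.lookup x w * \<omega> (letters w))"

lemma lin_ext_0 [simp]: "lin_ext \<omega> 0 = 0"
  by (simp add: lin_ext_def)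

lemma lin_ext_single [simp]: "lin_ext \<omega> (Poly_Mapping.single w k) = k * \<omega> (letters w)"
  by (simp add: lin_ext_def)

lemma lin_ext_add: "lin_ext \<omega> (x + y) = lin_ext \<omega> x + lin_ext \<omega> y"
  unfolding lin_ext_def by (rule setsum_keys_plus_distrib) (simp_all add: algebra_simps)

lemma lin_ext_diff: "lin_ext \<omega> (x - y) = lin_ext \<omega> x - lin_ext \<omega> y"
  using lin_ext_add[of \<omega> "x - y" y] by (simp add: algebra_simps)

lemma free_alg_induct [case_names zero single add]:
  fixes x :: free_alg
  assumes "P 0" "\<And>w k. P (Poly_Mapping.single w k)" "\<And>x y. P x \<Longrightarrow> P y \<Longrightarrow> P (x + y)"
  shows "P x"
proof (induction x rule: update_induct)
  case (update f a b)
  have "Poly_Mapping.update a b f = f + Poly_Mapping.single a b"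
    using update(1)
    by (intro poly_mapping_eqI)
       (auto simp: lookup_update lookup_add lookup_single in_keys_iff when_def)
  then show ?case
    using assms update by simp
qed (fact assms)

lemma letters_plus [simp]: "letters (u + v) = letters u @ letters v"
  by (simp add: plus_word_def)

lemma letters_0 [simp]: "letters 0 = []"
  by (simp add: zero_word_def)

lemma lin_ext_scale: "lin_ext \<omega> (Poly_Mapping.single 0 k * x) = k * lin_ext \<omega> x"
  by (induction x rule: free_alg_induct)
     (simp_all add: lin_ext_add algebra_simps mult_single)

text \<open>By linearity \<open>x\<close> and \<open>y\<close> may be taken to be single words,
  which then form the context in the last clause of \<open>word_functional\<close>.\<close>

lemma lin_ext_DE:
  assumes "word_functional \<omega>"
  shows "lin_ext \<omega> (x * (free_D * free_E - (free_D + free_E)) * y) = 0"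
proof (induction x rule: free_alg_induct)
  case (single u k)
  show ?case
  proof (induction y rule: free_alg_induct)
    case (single v l)
    have "\<omega> (letters u @ LetD # LetE # letters v)
        = \<omega> (letters u @ LetD # letters v) + \<omega> (letters u @ LetE # letters v)"
      using assms by (simp add: word_functional_def)
    then show ?case
      by (simp add: free_D_def free_E_def algebra_simps mult_single lin_ext_diff lin_ext_add)
  qed (simp_all add: lin_ext_add distrib_left)
qed (simp_all add: lin_ext_add distrib_right)

lemma lin_ext_ideal:
  assumes "word_functional \<omega>" "x \<in> dehp_ideal"
  shows "lin_ext \<omega> x = 0"
proof -
  \<comment> \<open>The claim is strengthened to two-sided multiples because the closure rules of
    the ideal multiply on either side.\<close>
  have "lin_ext \<omega> (a * x * b) = 0" for a b
    using assms(2)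
  proof (induction x arbitrary: a b)
    case gen
    then show ?case
      by (rule lin_ext_DE[OF assms(1)])
  next
    case (add x y)
    then show ?case
      by (simp add: lin_ext_add distrib_left distrib_right)
  next
    case (left x z)
    then show ?case
      using left.IH[of "a * z" b] by (simp add: mult.assoc)
  next
    case (right x z)
    then show ?case
      using right.IH[of a "z * b"] by (simp add: mult.assoc)
  qed simp
  from this[of 1 1] show ?thesis
    by simp
qed

lemma dehp_alg_cases: obtains x where "X = abs_dehp_alg x"
  using Quotient3_abs_rep[OF Quotient3_dehp_alg, of X] by metis

lemma ex_dehp_functional:
  assumes "word_functional \<omega>"
  shows "\<exists>f. is_dehp_functional f"
proof -
  \<comment> \<open>The value is taken at a chosen representative; \<open>f_abs\<close> shows that
    any other gives the same, because \<open>lin_ext\<close> vanishes on the ideal.\<close>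
  define f where "f X = lin_ext \<omega> (rep_dehp_alg X)" for X
  have f_abs: "f (abs_dehp_alg x) = lin_ext \<omega> x" for x
  proof -
    have "dehp_cong (rep_dehp_alg (abs_dehp_alg x)) x"
      by (rule Quotient3_rep_abs[OF Quotient3_dehp_alg]) (simp add: dehp_cong_def dehp_ideal.zero)
    then have "lin_ext \<omega> (rep_dehp_alg (abs_dehp_alg x) - x) = 0"
      using lin_ext_ideal[OF assms] by (simp add: dehp_cong_def)
    then show ?thesis
      by (simp add: f_def lin_ext_diff)
  qed
  have rules: "\<omega> [] = 1" "\<And>w. \<omega> (LetE # w) = abar * \<omega> w" "\<And>w. \<omega> (w @ [LetD]) = bbar * \<omega> w"
    using assms by (simp_all add: word_functional_def)
  have E: "lin_ext \<omega> (free_E * x) = abar * lin_ext \<omega> x" for x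
    by (induction x rule: free_alg_induct)
       (simp_all add: free_E_def mult_single rules distrib_left lin_ext_add)
  have D: "lin_ext \<omega> (x * free_D) = bbar * lin_ext \<omega> x" for x
    by (induction x rule: free_alg_induct)
       (simp_all add: free_D_def mult_single rules distrib_left distrib_right lin_ext_add)
  have "f (X + Y) = f X + f Y" for X Y
    by (cases X rule: dehp_alg_cases; cases Y rule: dehp_alg_cases) (simp add: plus_dehp_alg.abs_eq f_abs lin_ext_add)
  moreover have "f (scalar k * X) = k * f X" for k X
    by (cases X rule: dehp_alg_cases) (simp add: scalar.abs_eq times_dehp_alg.abs_eq f_abs lin_ext_scale)
  moreover have "f 1 = 1"
    using lin_ext_single[of \<omega> 0 1] by (simp add: one_dehp_alg.abs_eq f_abs rules)
  moreover have "f (gen_E * X) = abar * f X" for X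
    by (cases X rule: dehp_alg_cases) (simp add: gen_E.abs_eq times_dehp_alg.abs_eq f_abs E)
  moreover have "f (X * gen_D) = bbar * f X" for X
    by (cases X rule: dehp_alg_cases) (simp add: gen_D.abs_eq times_dehp_alg.abs_eq f_abs D)
  ultimately have "is_dehp_functional f"
    by (simp add: is_dehp_functional_def K_linear_def)
  then show ?thesis
    by blast
qed

section \<open>Classes of words and uniqueness of the functional\<close>

definition word_elem :: "letter list \<Rightarrow> dehp_alg" where
  "word_elem w = abs_dehp_alg (Poly_Mapping.single (Word w) 1)"

lemma word_elem_append: "word_elem (u @ v) = word_elem u * word_elem v"
  by (simp add: word_elem_def times_dehp_alg.abs_eq mult_single plus_word_def)

lemma word_elem_Nil: "word_elem [] = 1"
  by (simp add: word_elem_def one_dehp_alg.abs_eq flip: zero_word_def)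

lemma word_elem_D: "word_elem [LetD] = gen_D"
  by (simp add: word_elem_def gen_D.abs_eq free_D_def)

lemma word_elem_E: "word_elem [LetE] = gen_E"
  by (simp add: word_elem_def gen_E.abs_eq free_E_def)

lemma gen_D_gen_E: "gen_D * gen_E = gen_D + gen_E"
  using dehp_ideal.gen
  by (simp add: gen_D.abs_eq gen_E.abs_eq times_dehp_alg.abs_eq plus_dehp_alg.abs_eq
      dehp_alg.abs_eq_iff dehp_cong_def)

lemma dehp_functional_add: "is_dehp_functional f \<Longrightarrow> f (X + Y) = f X + f Y"
  and dehp_functional_scale: "is_dehp_functional f \<Longrightarrow> f (scalar k * X) = k * f X"
  and dehp_functional_1: "is_dehp_functional f \<Longrightarrow> f 1 = 1"
  and dehp_functional_E: "is_dehp_functional f \<Longrightarrow> f (gen_E * X) = abar * f X"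
  and dehp_functional_D: "is_dehp_functional f \<Longrightarrow> f (X * gen_D) = bbar * f X"
  by (simp_all add: is_dehp_functional_def K_linear_def)

lemma dehp_functional_word:
  assumes "is_dehp_functional f"
  shows "word_functional (\<lambda>w. f (word_elem w))"
proof -
  have "word_elem (LetE # w) = gen_E * word_elem w" for w
    using word_elem_append[of "[LetE]" w] by (simp add: word_elem_E)
  moreover have "word_elem (u @ [LetD, LetE] @ v)
      = word_elem (u @ [LetD] @ v) + word_elem (u @ [LetE] @ v)" for u v
  proof -
    have "word_elem (u @ [LetD, LetE] @ v) = word_elem (u @ [LetD] @ [LetE] @ v)"
      by simp
    also have "\<dots> = word_elem u * ((gen_D * gen_E) * word_elem v)"
      by (simp only: word_elem_append word_elem_D word_elem_E mult.assoc)
    also have "\<dots> = word_elem (u @ [LetD] @ v) + word_elem (u @ [LetE] @ v)"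
      by (simp only: word_elem_append word_elem_D word_elem_E gen_D_gen_E distrib_left distrib_right)
    finally show ?thesis .
  qed
  ultimately show ?thesis
    unfolding word_functional_def
    using assms
    by (simp only: word_elem_Nil word_elem_append[of _ "[LetD]"] word_elem_D
        dehp_functional_1 dehp_functional_E dehp_functional_D dehp_functional_add simp_thms)
qed

text \<open>Scalar multiples of classes of words generate the algebra additively, so uniqueness on
  words carries over.\<close>

lemma dehp_functional_unique:
  assumes "is_dehp_functional f" "is_dehp_functional g"
  shows "f = g"
proof
  fix X
  obtain x where X: "X = abs_dehp_alg x"
    by (cases X rule: dehp_alg_cases)
  have words: "f (word_elem w) = g (word_elem w)" for w
    using word_functional_unique[OF dehp_functional_word[OF assms(1)] dehp_functional_word[OF assms(2)]] .
  have "f (abs_dehp_alg x) = g (abs_dehp_alg x)"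
  proof (induction x rule: free_alg_induct)
    case zero
    have "h 0 = 0" if "is_dehp_functional h" for h
      using dehp_functional_add[OF that, of 0 0] by simp
    from this[OF assms(1)] this[OF assms(2)] show ?case
      by (simp flip: zero_dehp_alg.abs_eq)
  next
    case (single w k)
    have "abs_dehp_alg (Poly_Mapping.single w k) = scalar k * word_elem (letters w)"
      by (simp add: scalar.abs_eq word_elem_def times_dehp_alg.abs_eq mult_single)
    then show ?case
      using assms by (simp add: dehp_functional_scale words)
  next
    case (add x y)
    then show ?case
      using assms by (simp add: dehp_functional_add flip: plus_dehp_alg.abs_eq)
  qed
  then show "f X = g X"
    by (simp add: X)
qed

lemma word_elem_power: "(gen_D * gen_E) ^ n = word_elem (concat (replicate n [LetD, LetE]))"
proof (induction n)
  case (Suc n)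
  have "word_elem (concat (replicate (Suc n) [LetD, LetE]))
      = word_elem ([LetD] @ [LetE] @ concat (replicate n [LetD, LetE]))"
    by simp
  then show ?case
    by (simp only: word_elem_append word_elem_D word_elem_E power_Suc Suc mult.assoc)
qed (simp add: word_elem_Nil)

text \<open>One word functional serves twice: it gives the existence required by the
  \<open>THE\<close> in \<open>phi\<close>, and by uniqueness it computes \<open>phi\<close> on
  words.\<close>

lemma Z_eq_word_functional:
  assumes "word_functional \<omega>"
  shows "Z n = \<omega> (concat (replicate n [LetD, LetE]))"
proof -
  have "\<exists>!f. is_dehp_functional f"
    using ex_dehp_functional[OF assms] dehp_functional_unique by blast
  then have "is_dehp_functional phi"
    unfolding phi_def by (rule theI')
  from word_functional_unique[OF dehp_functional_word[OF this] assms] show ?thesis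
    by (simp add: Z_def word_elem_power)
qed

section \<open>Power series in \<open>c\<close> and \<open>d\<close>\<close>

lemma K_eqI: "(\<And>i j. coeff_cd f i j = coeff_cd g i j) \<Longrightarrow> f = g"
  by (simp add: coeff_cd_def fps_eq_iff)

lemma coeff_cd_0 [simp]: "coeff_cd 0 i j = 0"
  by (simp add: coeff_cd_def)

lemma coeff_cd_add: "coeff_cd (f + g) i j = coeff_cd f i j + coeff_cd g i j"
  by (simp add: coeff_cd_def)

lemma coeff_cd_sum: "coeff_cd (sum f A) i j = (\<Sum>a\<in>A. coeff_cd (f a) i j)"
  by (simp add: coeff_cd_def fps_sum_nth)

lemma coeff_cd_c_power_mult:
  "coeff_cd (c ^ k * f) i j = (if i < k then 0 else coeff_cd f (i - k) j)"
  by (simp add: coeff_cd_def c_def fps_const_power fps_X_power_mult_nth)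

lemma coeff_cd_c_mult: "coeff_cd (c * f) i j = (if i = 0 then 0 else coeff_cd f (i - 1) j)"
  using coeff_cd_c_power_mult[of 1 f i j] by simp

lemma coeff_cd_d_mult: "coeff_cd (d * f) i j = (if j = 0 then 0 else coeff_cd f i (j - 1))"
  by (simp add: coeff_cd_def d_def)

lemma fps_const_sum: "fps_const (sum f A) = (\<Sum>a\<in>A. fps_const (f a))"
  by (simp add: fps_eq_iff fps_sum_nth)

text \<open>The root is the binomial series with exponent 1/2 evaluated at \<open>- c * d\<close>;
  its coefficient of \<open>d ^ n\<close> is \<open>c ^ n\<close> times the rational number
  \<open>u n\<close>.\<close>

lemma ex_kappa: "\<exists>k. k\<^sup>2 = 1 - c * d \<and> coeff_cd k 0 0 = 1"
proof -
  define s :: "rat fps" where "s = fps_binomial (1/2)"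
  define u where "u n = (-1) ^ n * fps_nth s n" for n
  define k :: K where "k = Abs_fps (\<lambda>n. fps_const (u n) * fps_X ^ n)"
  have s2: "s * s = 1 + fps_X"
    unfolding s_def fps_binomial_add_mult[symmetric] by (simp add: fps_binomial_1)
  have u: "(\<Sum>i=0..n. u i * u (n - i)) = (-1) ^ n * fps_nth (s * s) n" for n
    unfolding fps_mult_nth sum_distrib_left
  proof (intro sum.cong refl)
    fix i assume "i \<in> {0..n}"
    then have "(-1) ^ n = (-1) ^ i * ((-1) ^ (n - i) :: rat)"
      by (simp flip: power_add)
    then show "u i * u (n - i) = (-1) ^ n * (fps_nth s i * fps_nth s (n - i))"
      by (simp add: u_def)
  qed
  have "fps_nth (k * k) n = fps_nth (1 - c * d) n" for n
  proof -
    have "fps_nth (k * k) n = (\<Sum>i=0..n. fps_const (u i * u (n - i)) * fps_X ^ n)"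
      unfolding fps_mult_nth
    proof (intro sum.cong refl)
      fix i assume "i \<in> {0..n}"
      then have "fps_X ^ n = fps_X ^ i * (fps_X ^ (n - i) :: rat fps)"
        by (simp flip: power_add)
      then show "fps_nth k i * fps_nth k (n - i) = fps_const (u i * u (n - i)) * fps_X ^ n"
        by (simp add: k_def ac_simps flip: fps_const_mult)
    qed
    also have "\<dots> = fps_const (\<Sum>i=0..n. u i * u (n - i)) * fps_X ^ n"
      by (simp add: fps_const_sum sum_distrib_right)
    also have "\<dots> = fps_nth (1 - c * d) n"
    proof -
      \<comment> \<open>As \<open>s * s = 1 + fps_X\<close>, only the degrees 0 and 1
        survive.\<close>
      consider "n = 0" | "n = 1" | "n > 1"
        by linarith
      then show ?thesis
        unfolding u s2 by cases (simp_all add: c_def d_def flip: fps_const_neg)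
    qed
    finally show ?thesis .
  qed
  then have "k\<^sup>2 = 1 - c * d"
    unfolding power2_eq_square by (rule fps_ext)
  moreover have "coeff_cd k 0 0 = 1"
    by (simp add: coeff_cd_def k_def s_def u_def)
  ultimately show ?thesis
    by blast
qed

lemma kappa_square: "kappa\<^sup>2 = 1 - c * d"
proof -
  have "\<exists>!k. k\<^sup>2 = 1 - c * d \<and> coeff_cd k 0 0 = 1"
  proof (rule ex_ex1I[OF ex_kappa])
    fix k l :: K
    assume *: "k\<^sup>2 = 1 - c * d \<and> coeff_cd k 0 0 = 1" "l\<^sup>2 = 1 - c * d \<and> coeff_cd l 0 0 = 1"
    then have "k\<^sup>2 = l\<^sup>2"
      by simp
    then have "k = l \<or> k = - l"
      by (simp only: power2_eq_iff)
    \<comment> \<open>Comparing constant coefficients would give 1 = -1.\<close>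
    moreover have "k \<noteq> - l"
      using * by (auto simp: coeff_cd_def)
    ultimately show "k = l"
      by blast
  qed
  then have "kappa\<^sup>2 = 1 - c * d \<and> coeff_cd kappa 0 0 = 1"
    unfolding kappa_def by (rule theI')
  then show ?thesis ..
qed

section \<open>Matrix representations of the DEHP algebra\<close>

text \<open>
  The columns of the matrix of \<open>D\<close> behind the \<open>R1\<close> paths are finitely supported but its rows are
  not. So it multiplies row vectors rather than column vectors, and a word acts by \<^const>\<open>fold\<close>.
\<close>

fun row_act :: "letter \<Rightarrow> (nat \<Rightarrow> K) \<Rightarrow> nat \<Rightarrow> K" where
  "row_act LetD r j = bbar * r 0 + (\<Sum>i=1..j. r i)"
| "row_act LetE r j = r (Suc j)"

lemma row_act_add: "row_act l (\<lambda>j. r j + s j) = (\<lambda>j. row_act l r j + row_act l s j)"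
  by (cases l) (simp_all add: fun_eq_iff sum.distrib algebra_simps)

lemma row_act_scale: "row_act l (\<lambda>j. k * r j) = (\<lambda>j. k * row_act l r j)"
  by (cases l) (simp_all add: fun_eq_iff algebra_simps flip: sum_distrib_left)

text \<open>\<open>LetE\<close> reads entry \<open>Suc j\<close> of the partial sums, which exceeds
  entry \<open>j\<close> by \<open>r (Suc j)\<close>.\<close>

lemma row_act_D_E: "row_act LetE (row_act LetD r) = (\<lambda>j. row_act LetD r j + row_act LetE r j)"
  by (simp add: fun_eq_iff)

text \<open>Here \<open>W\<close> is the geometric row with ratio \<open>abar\<close>, and
  evaluation at 0 is multiplication by the first unit column \<open>V\<close>.\<close>

definition row_functional :: "letter list \<Rightarrow> K" where
  "row_functional w = fold row_act w (\<lambda>j. abar ^ j) 0"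

lemma word_functional_row: "word_functional row_functional"
proof -
  have add: "fold row_act w (\<lambda>j. r j + s j) = (\<lambda>j. fold row_act w r j + fold row_act w s j)" for w r s
    by (induction w arbitrary: r s) (simp_all add: row_act_add)
  have scale: "fold row_act w (\<lambda>j. k * r j) = (\<lambda>j. k * fold row_act w r j)" for w k r
    by (induction w arbitrary: r) (simp_all add: row_act_scale)
  have "row_act LetE (\<lambda>j. abar ^ j) = (\<lambda>j. abar * abar ^ j)"
    by (simp add: fun_eq_iff)
  moreover have "row_act LetD r 0 = bbar * r 0" for r
    by simp
  ultimately show ?thesis
    by (simp add: word_functional_def row_functional_def row_act_D_E add scale del: row_act.simps)
qed

text \<open>
  Bidiagonal matrices acting on column vectors; with \<open>(a, b, k) = (abar, bbar, kappa)\<close> they describe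
  the \<open>R3\<close> paths and with \<open>(1, 1, 1)\<close> the \<open>R2\<close> paths.
\<close>

fun col_act :: "K \<Rightarrow> K \<Rightarrow> K \<Rightarrow> letter \<Rightarrow> (nat \<Rightarrow> K) \<Rightarrow> nat \<Rightarrow> K" where
  "col_act a b k LetD f 0 = b * f 0 + k * f 1"
| "col_act a b k LetD f (Suc j) = f (Suc j) + f (Suc (Suc j))"
| "col_act a b k LetE f 0 = a * f 0"
| "col_act a b k LetE f (Suc j) = f (Suc j) + (if j = 0 then k else 1) * f j"

lemma col_act_add:
  "col_act a b k l (\<lambda>j. f j + g j) = (\<lambda>j. col_act a b k l f j + col_act a b k l g j)"
proof
  show "col_act a b k l (\<lambda>j. f j + g j) j = col_act a b k l f j + col_act a b k l g j" for j
    by (cases l; cases j) (simp_all add: algebra_simps)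
qed

lemma col_act_scale: "col_act a b k l (\<lambda>j. x * f j) = (\<lambda>j. x * col_act a b k l f j)"
proof
  show "col_act a b k l (\<lambda>j. x * f j) j = x * col_act a b k l f j" for j
    by (cases l; cases j) (simp_all add: algebra_simps)
qed

text \<open>In row 0 the coefficient of \<open>f 0\<close> is \<open>a * b + k * k\<close> on one
  side and \<open>a + b\<close> on the other, which dictates the choice of \<open>k\<close>.\<close>

lemma col_act_D_E:
  assumes "k * k = a + b - a * b"
  shows "col_act a b k LetD (col_act a b k LetE f)
    = (\<lambda>j. col_act a b k LetD f j + col_act a b k LetE f j)"
proof
  fix j
  consider "j = 0" | "j = 1" | i where "j = Suc (Suc i)"
    by (metis One_nat_def not0_implies_Suc)
  then show "col_act a b k LetD (col_act a b k LetE f) j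
      = col_act a b k LetD f j + col_act a b k LetE f j"
  proof cases
    case 1
    have "k * (f (Suc 0) + k * f 0) = k * f (Suc 0) + (a + b - a * b) * f 0"
      by (simp add: distrib_left assms flip: mult.assoc)
    then show ?thesis
      using 1 by (simp add: algebra_simps)
  qed simp_all
qed

text \<open>\<open>T\<close> is the row vector \<open>W\<close> as an abstract functional, which
  admits an infinite row as well as evaluation at 0. The hypotheses \<open>E\<close> and
  \<open>D\<close> are the eigenvector equations of \<open>W\<close> and \<open>V\<close>.\<close>

lemma word_functional_col:
  assumes k: "k * k = a + b - a * b"
    and add: "\<And>f g. T (\<lambda>j. f j + g j) = T f + T g"
    and scale: "\<And>f. T (\<lambda>j. bbar * f j) = bbar * T f"
    and E: "\<And>f. T (col_act a b k LetE f) = abar * T f"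
    and D: "col_act a b k LetD V = (\<lambda>j. bbar * V j)"
    and norm: "T V = 1"
  shows "word_functional (\<lambda>w. T (foldr (col_act a b k) w V))"
proof -
  have fadd: "foldr (col_act a b k) w (\<lambda>j. f j + g j)
      = (\<lambda>j. foldr (col_act a b k) w f j + foldr (col_act a b k) w g j)" for w f g
    by (induction w) (simp_all add: col_act_add)
  have fscale: "foldr (col_act a b k) w (\<lambda>j. x * f j) = (\<lambda>j. x * foldr (col_act a b k) w f j)"
    for w x f
    by (induction w) (simp_all add: col_act_scale)
  show ?thesis
    by (simp add: word_functional_def norm E D fscale scale col_act_D_E[OF k] fadd add)
qed

lemma abar_bbar: "abar + bbar - abar * bbar = kappa * kappa"
  using kappa_square by (simp add: abar_def bbar_def algebra_simps power2_eq_square)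

definition unit_vec :: "nat \<Rightarrow> K" where
  "unit_vec j = (if j = 0 then 1 else 0)"

lemma word_functional_col_unit:
  "word_functional (\<lambda>w. foldr (col_act abar bbar kappa) w unit_vec 0)"
proof (rule word_functional_col[where T = "\<lambda>f. f 0"])
  show "col_act abar bbar kappa LetD unit_vec = (\<lambda>j. bbar * unit_vec j)"
  proof
    show "col_act abar bbar kappa LetD unit_vec j = bbar * unit_vec j" for j
      by (cases j) (simp_all add: unit_vec_def)
  qed
qed (simp_all add: abar_bbar unit_vec_def)

text \<open>
  The \<open>c\<close>-adically convergent sum of all \<open>c\<^sup>k f k\<close>, i.e. the product of the row vector
  \<open>(1, c, c\<^sup>2, \<dots>)\<close> with the column \<open>f\<close>.
\<close>

definition c_series :: "(nat \<Rightarrow> K) \<Rightarrow> K" where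
  "c_series f = Abs_fps (\<lambda>j. Abs_fps (\<lambda>i. \<Sum>k\<le>i. coeff_cd (f k) (i - k) j))"

lemma coeff_cd_c_series: "coeff_cd (c_series f) i j = (\<Sum>k\<le>i. coeff_cd (f k) (i - k) j)"
  by (simp add: c_series_def coeff_cd_def)

lemma c_series_add: "c_series (\<lambda>k. f k + g k) = c_series f + c_series g"
  by (rule K_eqI) (simp add: coeff_cd_c_series coeff_cd_add sum.distrib)

lemma c_series_unfold: "c_series f = f 0 + c * c_series (\<lambda>k. f (Suc k))"
proof (rule K_eqI)
  show "coeff_cd (c_series f) i j = coeff_cd (f 0 + c * c_series (\<lambda>k. f (Suc k))) i j" for i j
    by (cases i)
       (simp_all add: coeff_cd_c_series coeff_cd_add coeff_cd_c_mult sum.atMost_Suc_shift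
         del: sum.atMost_Suc)
qed

lemma c_series_d: "c_series (\<lambda>k. d * f k) = d * c_series f"
  by (rule K_eqI) (simp add: coeff_cd_c_series coeff_cd_d_mult)

lemma c_series_c: "c_series (\<lambda>k. c * f k) = c * c_series f"
proof (rule K_eqI)
  fix i j
  show "coeff_cd (c_series (\<lambda>k. c * f k)) i j = coeff_cd (c * c_series f) i j"
  proof (cases i)
    case (Suc m)
    then show ?thesis
      by (simp add: coeff_cd_c_series coeff_cd_c_mult Suc_diff_le)
  qed (simp add: coeff_cd_c_series coeff_cd_c_mult)
qed

text \<open>Geometric vectors with ratios \<open>c\<close> and \<open>d\<close> are eigenvectors of
  the unweighted matrices, with eigenvalues \<open>1 + c\<close> and \<open>1 + d\<close>. Their
  product is the inverse of \<open>1 - c * d\<close>, which the factor \<open>kappa * kappa\<close>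
  cancels.\<close>

lemma word_functional_col_series:
  "word_functional (\<lambda>w. c_series (foldr (col_act 1 1 1) w (\<lambda>j. kappa * kappa * d ^ j)))"
proof (rule word_functional_col)
  show "c_series (\<lambda>j. bbar * f j) = bbar * c_series f" for f
    by (simp add: bbar_def distrib_right c_series_add c_series_d)
  show "c_series (col_act 1 1 1 LetE f) = abar * c_series f" for f
  proof -
    have "c_series (col_act 1 1 1 LetE f) = f 0 + c * c_series (\<lambda>k. f (Suc k) + f k)"
      by (subst c_series_unfold) simp
    also have "\<dots> = c_series f + c * c_series f"
      by (subst (2) c_series_unfold) (simp add: c_series_add algebra_simps)
    finally show ?thesis
      by (simp add: abar_def algebra_simps)
  qed
  show "col_act 1 1 1 LetD (\<lambda>j. kappa * kappa * d ^ j) = (\<lambda>j. bbar * (kappa * kappa * d ^ j))"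
  proof
    show "col_act 1 1 1 LetD (\<lambda>j. kappa * kappa * d ^ j) j = bbar * (kappa * kappa * d ^ j)" for j
      by (cases j) (simp_all add: bbar_def algebra_simps)
  qed
  \<comment> \<open>Writing the factor in this form lets the geometric series telescope without a
    division.\<close>
  have "kappa * kappa * x = x + c * (d * (- x))" for x
    unfolding power2_eq_square[symmetric] kappa_square by (simp add: algebra_simps)
  then have "c_series (\<lambda>j. kappa * kappa * d ^ j) = c_series (\<lambda>j. d ^ j + c * (d * (- (d ^ j))))"
    by simp
  also have "\<dots> = c_series (\<lambda>j. d ^ j) + c * c_series (\<lambda>j. d * (- (d ^ j)))"
    by (simp only: c_series_add c_series_c)
  also have "\<dots> = 1 + c * (c_series (\<lambda>j. d * d ^ j + d * (- (d ^ j))))"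
    unfolding c_series_add by (subst c_series_unfold) (simp add: algebra_simps)
  also have "c_series (\<lambda>j. d * d ^ j + d * (- (d ^ j))) = 0"
    by (rule K_eqI) (simp add: coeff_cd_c_series)
  finally show "c_series (\<lambda>j. kappa * kappa * d ^ j) = 1"
    by simp
qed (simp_all add: c_series_add)

section \<open>Sums over lattice paths\<close>

lemma paths_0: "paths steps {v} ends 0 = (if v \<in> ends then {[v]} else {})"
  by (auto simp: paths_def length_Suc_conv)

lemma paths_Suc:
  "paths steps {v} ends (Suc n) =
     (\<Union>v'\<in>{v'. displacement v v' \<in> steps 1}. (#) v ` paths (\<lambda>i. steps (Suc i)) {v'} ends n)"
proof (intro equalityI subsetI)
  fix p assume p: "p \<in> paths steps {v} ends (Suc n)"
  then obtain v' q where q: "p = v # q" "length q = n + 1" "q ! 0 = v'"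
    by (auto simp: paths_def length_Suc_conv)
  have step: "displacement (p ! (i - 1)) (p ! i) \<in> steps i" if "i \<in> {1..Suc n}" for i
    using p that by (simp add: paths_def)
  have "displacement v v' \<in> steps 1"
    using step[of 1] q by simp
  moreover have "displacement (q ! (i - 1)) (q ! i) \<in> steps (Suc i)" if "i \<in> {1..n}" for i
    using step[of "Suc i"] that q by (simp add: nth_Cons')
  then have "q \<in> paths (\<lambda>i. steps (Suc i)) {v'} ends n"
    using p q by (simp add: paths_def)
  ultimately show "p \<in> (\<Union>v'\<in>{v'. displacement v v' \<in> steps 1}.
      (#) v ` paths (\<lambda>i. steps (Suc i)) {v'} ends n)"
    using q by blast
next
  fix p assume "p \<in> (\<Union>v'\<in>{v'. displacement v v' \<in> steps 1}.
      (#) v ` paths (\<lambda>i. steps (Suc i)) {v'} ends n)"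
  then obtain v' q where v': "displacement v v' \<in> steps 1" and p: "p = v # q"
    and q: "q \<in> paths (\<lambda>i. steps (Suc i)) {v'} ends n"
    by blast
  have "displacement (p ! (i - 1)) (p ! i) \<in> steps i" if i: "i \<in> {1..Suc n}" for i
  proof (cases "i = 1")
    case True
    then show ?thesis
      using v' p q by (simp add: paths_def)
  next
    case False
    with i obtain m where "i = Suc m" "m \<in> {1..n}"
      by (cases i) auto
    then show ?thesis
      using p q by (simp add: paths_def nth_Cons')
  qed
  then show "p \<in> paths steps {v} ends (Suc n)"
    using p q by (simp add: paths_def)
qed

lemma paths_Union: "paths steps (\<Union>k\<in>I. {f k}) ends n = (\<Union>k\<in>I. paths steps {f k} ends n)"
  by (auto simp: paths_def)

lemma paths_empty_hd: "u \<noteq> v \<Longrightarrow> paths steps {u} ends n \<inter> paths steps' {v} ends' m = {}"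
  by (auto simp: paths_def)

lemma paths_hd: "p \<in> paths steps {v} ends n \<Longrightarrow> hd p = v \<and> p \<noteq> []"
  by (auto simp: paths_def hd_conv_nth simp flip: length_greater_0_conv)

lemma path_weight_start: "path_weight ws we w p = ws (hd p) * path_weight (\<lambda>v. 1) we w p"
  by (simp add: path_weight_def)

lemma path_weight_Cons:
  assumes "q \<noteq> []"
  shows "path_weight (\<lambda>v. 1) we w (v # q) =
    w 1 v (hd q) * path_weight (\<lambda>v. 1) we (\<lambda>i. w (Suc i)) q"
proof -
  obtain m where m: "length q = Suc m"
    using assms by (cases q) auto
  have "(\<Prod>i\<in>{1..Suc m}. w i ((v # q) ! (i - 1)) ((v # q) ! i))
      = w 1 v (q ! 0) * (\<Prod>i\<in>{1..m}. w (Suc i) ((v # q) ! i) (q ! i))"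
    by (subst prod.atLeast_Suc_atMost) (simp_all add: prod.shift_bounds_cl_Suc_ivl del: prod.cl_ivl_Suc)
  also have "(\<Prod>i\<in>{1..m}. w (Suc i) ((v # q) ! i) (q ! i))
      = (\<Prod>i\<in>{1..m}. w (Suc i) (q ! (i - 1)) (q ! i))"
    by (intro prod.cong) (auto simp: nth_Cons')
  finally show ?thesis
    using assms m by (simp add: path_weight_def hd_conv_nth mult_ac)
qed

text \<open>The initial weight is left out so that splitting off the first step gives a recursion;
  \<open>sum_path_weight_eq\<close> restores it.\<close>

definition path_sum ::
    "(nat \<Rightarrow> (int \<times> int) set) \<Rightarrow> vertex set \<Rightarrow> (vertex \<Rightarrow> K) \<Rightarrow> (nat \<Rightarrow> vertex \<Rightarrow> vertex \<Rightarrow> K) \<Rightarrow>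
      nat \<Rightarrow> vertex \<Rightarrow> K" where
  "path_sum steps ends we w n v = (\<Sum>p\<in>paths steps {v} ends n. path_weight (\<lambda>v. 1) we w p)"

lemma path_sum_0: "path_sum steps ends we w 0 v = (if v \<in> ends then we v else 0)"
  by (simp add: path_sum_def paths_0 path_weight_def)

text \<open>\<open>N\<close> is any finite set of successors that contains all those from which
  \<open>ends\<close> can be reached. This accommodates the unbounded jumps of
  \<open>R1\<close>.\<close>

lemma path_sum_Suc:
  assumes N: "finite N" "\<And>v'. v' \<in> N \<Longrightarrow> displacement v v' \<in> steps 1"
    and fin: "\<And>v'. v' \<in> N \<Longrightarrow> finite (paths (\<lambda>i. steps (Suc i)) {v'} ends n)"
    and empty: "\<And>v'. displacement v v' \<in> steps 1 \<Longrightarrow> v' \<notin> N \<Longrightarrow>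
      paths (\<lambda>i. steps (Suc i)) {v'} ends n = {}"
  shows "finite (paths steps {v} ends (Suc n))"
    and "path_sum steps ends we w (Suc n) v =
      (\<Sum>v'\<in>N. w 1 v v' * path_sum (\<lambda>i. steps (Suc i)) ends we (\<lambda>i. w (Suc i)) n v')"
proof -
  let ?P = "\<lambda>v'. (#) v ` paths (\<lambda>i. steps (Suc i)) {v'} ends n"
  have eq: "paths steps {v} ends (Suc n) = (\<Union>v'\<in>N. ?P v')"
    unfolding paths_Suc using N(2) empty by fastforce
  show "finite (paths steps {v} ends (Suc n))"
    unfolding eq using N fin by blast
  have "path_sum steps ends we w (Suc n) v = (\<Sum>v'\<in>N. \<Sum>p\<in>?P v'. path_weight (\<lambda>v. 1) we w p)"
    unfolding path_sum_def eq
  proof (rule sum.UNION_disjoint)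
    show "\<forall>u\<in>N. \<forall>v\<in>N. u \<noteq> v \<longrightarrow> ?P u \<inter> ?P v = {}"
      using paths_empty_hd by fast
  qed (use N fin in auto)
  also have "\<dots> = (\<Sum>v'\<in>N. w 1 v v' * path_sum (\<lambda>i. steps (Suc i)) ends we (\<lambda>i. w (Suc i)) n v')"
  proof (rule sum.cong[OF refl])
    fix v' assume "v' \<in> N"
    have "(\<Sum>p\<in>?P v'. path_weight (\<lambda>v. 1) we w p) =
        (\<Sum>q\<in>paths (\<lambda>i. steps (Suc i)) {v'} ends n. path_weight (\<lambda>v. 1) we w (v # q))"
      by (subst sum.reindex) auto
    also have "\<dots> = (\<Sum>q\<in>paths (\<lambda>i. steps (Suc i)) {v'} ends n.
        w 1 v v' * path_weight (\<lambda>v. 1) we (\<lambda>i. w (Suc i)) q)"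
      by (intro sum.cong) (auto simp: path_weight_Cons dest: paths_hd)
    finally show "(\<Sum>p\<in>?P v'. path_weight (\<lambda>v. 1) we w p) =
        w 1 v v' * path_sum (\<lambda>i. steps (Suc i)) ends we (\<lambda>i. w (Suc i)) n v'"
      by (simp add: path_sum_def sum_distrib_left)
  qed
  finally show "path_sum steps ends we w (Suc n) v =
      (\<Sum>v'\<in>N. w 1 v v' * path_sum (\<lambda>i. steps (Suc i)) ends we (\<lambda>i. w (Suc i)) n v')" .
qed

lemma sum_path_weight_eq:
  "(\<Sum>p\<in>paths steps {v} ends n. path_weight ws we w p) = ws v * path_sum steps ends we w n v"
  unfolding path_sum_def sum_distrib_left
  by (intro sum.cong refl, subst path_weight_start) (auto dest: paths_hd)

text \<open>A step lowers the height by at most 1. For \<open>R1\<close> this leaves only finitely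
  many useful start and jump heights.\<close>

lemma paths_height_le:
  assumes "p \<in> paths steps {v} ends n" "\<And>i a. a \<in> steps i \<Longrightarrow> snd a \<ge> -1"
  shows "\<exists>u\<in>ends. snd v \<le> snd u + n"
proof -
  have "int (snd v) \<le> int (snd (p ! m)) + int m" if "m \<le> n" for m
    using that
  proof (induction m)
    case 0
    then show ?case
      using assms by (simp add: paths_def)
  next
    case (Suc m)
    then have "displacement (p ! m) (p ! Suc m) \<in> steps (Suc m)"
      using assms(1) by (auto simp: paths_def dest: bspec[of _ _ "Suc m"])
    from assms(2)[OF this] Suc show ?case
      by (simp add: displacement_def)
  qed
  from this[of n] show ?thesis
    using assms(1) by (intro bexI[of _ "p ! n"]) (auto simp: paths_def)
qed

text \<open>The first coordinates are dropped. \<open>s\<close> counts the steps already taken, so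
  that the next step has number \<open>Suc s\<close>, and \<open>z\<close> weights the final
  height.\<close>

primrec height_sum ::
    "(nat \<Rightarrow> K) \<Rightarrow> (nat \<Rightarrow> nat \<Rightarrow> nat \<Rightarrow> K) \<Rightarrow> nat \<Rightarrow> nat \<Rightarrow> nat \<Rightarrow> K" where
  "height_sum z w 0 s h = z h"
| "height_sum z w (Suc n) s h =
     w (Suc s) h (Suc h) * height_sum z w n (Suc s) (Suc h) +
     (if h = 0 then 0 else w (Suc s) h (h - 1) * height_sum z w n (Suc s) (h - 1))"

lemma updown_Suc: "(\<lambda>i. updown (Suc i)) = updown"
  by (simp add: fun_eq_iff updown_def)

lemma path_sum_updown:
  "finite (paths updown {(x, h)} ends n) \<and>
   path_sum updown ends we (\<lambda>i u v. w (s + i) (snd u) (snd v)) n (x, h) =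
   height_sum (\<lambda>h. if (x + int n, h) \<in> ends then we (x + int n, h) else 0) w n s h"
proof (induction n arbitrary: x h s)
  case 0
  then show ?case
    by (simp add: path_sum_0 paths_0)
next
  case (Suc n)
  define N where "N = insert (x + 1, Suc h) (if h = 0 then {} else {(x + 1, h - 1)})"
  have x: "x + int (Suc n) = x + 1 + int n"
    by simp
  have N: "finite N" "displacement (x, h) v' \<in> updown 1 \<longleftrightarrow> v' \<in> N" for v'
    by (cases v'; auto simp: N_def displacement_def updown_def)+
  have fin: "finite (paths (\<lambda>i. updown (Suc i)) {v'} ends n)" for v'
    unfolding updown_Suc using Suc.IH by (cases v') blast
  note sum = path_sum_Suc[of N "(x, h)" updown ends n, OF N(1) _ fin]
  have "finite (paths updown {(x, h)} ends (Suc n))"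
    by (rule sum(1)) (use N in auto)
  moreover have "path_sum updown ends we (\<lambda>i u v. w (s + i) (snd u) (snd v)) (Suc n) (x, h) =
      (\<Sum>v'\<in>N. w (Suc s) h (snd v') *
        path_sum updown ends we (\<lambda>i u v. w (Suc s + i) (snd u) (snd v)) n v')"
    by (subst sum(2)) (use N in \<open>auto simp: updown_Suc\<close>)
  moreover have "\<dots> = height_sum (\<lambda>h. if (x + int (Suc n), h) \<in> ends
      then we (x + int (Suc n), h) else 0) w (Suc n) s h"
    unfolding x using Suc.IH[of "x + 1" _ "Suc s"] by (simp add: N_def)
  ultimately show ?case
    by simp
qed

lemmas finite_paths_updown = path_sum_updown[THEN conjunct1]

lemma path_sum_updown_0:
  "path_sum updown ends we (\<lambda>i u v. w i (snd u) (snd v)) n (0, h) =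
   height_sum (\<lambda>h. if (int n, h) \<in> ends then we (int n, h) else 0) w n 0 h"
  using path_sum_updown[of 0 h ends n we w 0] by (simp cong: if_cong)

section \<open>The paths R2 and R3\<close>

definition bidiag_weight :: "K \<Rightarrow> K \<Rightarrow> K \<Rightarrow> nat \<Rightarrow> nat \<Rightarrow> K" where
  "bidiag_weight a b k h h' =
     (if (h = 1 \<and> h' = 2) \<or> (h = 2 \<and> h' = 1) then k
      else if h = 1 \<and> h' = 0 then b
      else if h = 0 \<and> h' = 1 then a
      else 1)"

text \<open>Heights \<open>2 * j\<close> and \<open>2 * j + 1\<close> share the index
  \<open>j\<close>. From an odd height the index stays or rises, giving the upper bidiagonal
  \<open>D\<close>; from an even height it stays or drops, giving the lower bidiagonal
  \<open>E\<close>.\<close>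

lemma height_sum_D:
  "height_sum z (\<lambda>i. bidiag_weight a b k) (Suc n) s (2 * j + 1) =
   col_act a b k LetD (\<lambda>j. height_sum z (\<lambda>i. bidiag_weight a b k) n (Suc s) (2 * j)) j"
  by (cases j) (simp_all add: bidiag_weight_def numeral_2_eq_2)

lemma height_sum_E:
  "height_sum z (\<lambda>i. bidiag_weight a b k) (Suc n) s (2 * j) =
   col_act a b k LetE (\<lambda>j. height_sum z (\<lambda>i. bidiag_weight a b k) n (Suc s) (2 * j + 1)) j"
  by (cases j) (simp_all add: bidiag_weight_def numeral_2_eq_2)

lemma height_sum_col:
  "height_sum z (\<lambda>i. bidiag_weight a b k) (2 * n) s (2 * j + 1) =
   foldr (col_act a b k) (concat (replicate n [LetD, LetE])) (\<lambda>j. z (2 * j + 1)) j"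
proof (induction n arbitrary: s j)
  case (Suc n)
  have "2 * Suc n = Suc (Suc (2 * n))"
    by simp
  then show ?case
    by (simp only: height_sum_D height_sum_E Suc.IH) simp
qed simp

definition at_height_1 :: "nat \<Rightarrow> K" where
  "at_height_1 h = (if h = 1 then 1 else 0)"

lemma sum_paths_height_1:
  "(\<Sum>p\<in>R3 n. path_weight (\<lambda>v. 1) (\<lambda>v. 1) (\<lambda>i u v. w i (snd u) (snd v)) p) =
   height_sum at_height_1 w (2 * n) 0 1"
proof -
  have "(\<lambda>h. if (int (2 * n), h) \<in> {(2 * int n, 1)} then 1 else 0) = at_height_1"
    by (simp add: fun_eq_iff at_height_1_def)
  then show ?thesis
    unfolding R3_def sum_path_weight_eq path_sum_updown_0 by simp
qed

lemma finite_R3: "finite (R3 n)"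
  unfolding R3_def by (rule finite_paths_updown)

lemma sum_R3:
  "(\<Sum>p\<in>R3 n. W3 p) = height_sum at_height_1 (\<lambda>i. bidiag_weight abar bbar kappa) (2 * n) 0 1"
  unfolding sum_paths_height_1[symmetric] W3_def bidiag_weight_def ..

lemma Z_eq_height_sum:
  "Z n = height_sum at_height_1 (\<lambda>i. bidiag_weight abar bbar kappa) (2 * n) 0 1"
proof -
  have "(\<lambda>j. at_height_1 (2 * j + 1)) = unit_vec"
    by (simp add: fun_eq_iff unit_vec_def at_height_1_def)
  then show ?thesis
    using height_sum_col[of at_height_1 abar bbar kappa n 0 0]
    by (simp add: Z_eq_word_functional[OF word_functional_col_unit])
qed

section \<open>The infinite family of \<open>R2\<close> paths and its coefficientwise sum\<close>

lemma infinite_R2: "infinite (R2 n)"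
proof -
  \<comment> \<open>One path for each start height, oscillating between \<open>2 * k + 1\<close> and
    \<open>2 * k + 2\<close>.\<close>
  define zigzag where
    "zigzag k = map (\<lambda>i. (int i, 2 * k + 1 + i mod 2)) [0..<2 * n + 1]" for k :: nat
  have "inj zigzag"
  proof (rule injI)
    fix k l assume "zigzag k = zigzag l"
    then have "zigzag k ! 0 = zigzag l ! 0"
      by simp
    then show "k = l"
      by (simp add: zigzag_def del: upt_Suc)
  qed
  moreover have "zigzag k \<in> R2 n" for k
  proof -
    have "displacement (int (i - 1), 2 * k + 1 + (i - 1) mod 2) (int i, 2 * k + 1 + i mod 2)
        \<in> updown i" if "i \<ge> 1" for i
      using that by (cases i) (auto simp: displacement_def updown_def mod_Suc)
    then show ?thesis
      by (auto simp: R2_def paths_def zigzag_def simp del: upt_Suc)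
  qed
  ultimately show ?thesis
    by (metis finite_subset image_subsetI infinite_UNIV_nat finite_imageD)
qed

text \<open>Paths that start at height \<open>2 * k + 1\<close> carry the factor
  \<open>c ^ k\<close>, so only the finitely many with \<open>k \<le> i\<close> affect a coefficient
  of \<open>c ^ i\<close>.\<close>

lemma fps_sums_on_R2: "fps_sums_on W2 (R2 n) (Z n)"
  unfolding fps_sums_on_def
proof (intro allI)
  fix i j
  define ends :: "vertex set" where "ends = {(2 * int n, 2 * k' + 1) | k'. True}"
  define P where "P k = paths updown {(0, 2 * k + 1)} ends (2 * n)" for k :: nat
  \<comment> \<open>Both factors \<open>kappa\<close> are moved to the final vertex, matching the
    column vector of the representation.\<close>
  define we where "we v = kappa * kappa * d ^ (snd v div 2)" for v :: vertex
  define S where "S = foldr (col_act 1 1 1) (concat (replicate n [LetD, LetE]))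
    (\<lambda>j. kappa * kappa * d ^ j)"
  define B where "B = (\<Union>k\<le>i. P k)"
  have W2: "W2 p = path_weight (\<lambda>v. c ^ (snd v div 2)) we (\<lambda>i u v. 1) p" for p
    by (simp add: W2_def path_weight_def we_def mult_ac)
  have R2: "R2 n = (\<Union>k. P k)"
    unfolding P_def paths_Union[symmetric] R2_def ends_def by (rule arg_cong2) auto
  have fin: "finite (P k)" for k
    unfolding P_def by (rule finite_paths_updown)
  have sum_P: "(\<Sum>p\<in>P k. W2 p) = c ^ k * S k" for k
  proof -
    have "path_sum updown ends we (\<lambda>i u v. 1) (2 * n) (0, 2 * k + 1)
        = height_sum (\<lambda>h. if (int (2 * n), h) \<in> ends then we (int (2 * n), h) else 0)
            (\<lambda>i. bidiag_weight 1 1 1) (2 * n) 0 (2 * k + 1)"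
      using path_sum_updown_0[of ends we "\<lambda>i h h'. 1" "2 * n" "2 * k + 1"]
      by (simp add: bidiag_weight_def[abs_def] cong: if_cong)
    also have "\<dots> = S k"
      unfolding height_sum_col S_def by (simp add: ends_def we_def)
    finally show ?thesis
      unfolding W2 P_def sum_path_weight_eq by simp
  qed
  have coeff_0: "coeff_cd (W2 p) i j = 0" if "p \<in> P k" "i < k" for p k
  proof -
    have "W2 p = c ^ k * path_weight (\<lambda>v. 1) we (\<lambda>i u v. 1) p"
      using that paths_hd[of p] unfolding W2 P_def by (subst path_weight_start) auto
    then show ?thesis
      using that by (simp add: coeff_cd_c_power_mult)
  qed
  have "finite B"
    using fin by (simp add: B_def)
  have sub: "{p \<in> R2 n. coeff_cd (W2 p) i j \<noteq> 0} \<subseteq> B"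
    unfolding R2 B_def using coeff_0 by (auto, metis atMost_iff linorder_not_less)
  then have "finite {p \<in> R2 n. coeff_cd (W2 p) i j \<noteq> 0}"
    using \<open>finite B\<close> by (rule finite_subset)
  moreover have "(\<Sum>p | p \<in> R2 n \<and> coeff_cd (W2 p) i j \<noteq> 0. coeff_cd (W2 p) i j)
      = (\<Sum>p\<in>B. coeff_cd (W2 p) i j)"
    using \<open>finite B\<close> sub by (rule sum.mono_neutral_left) (auto simp: R2 B_def)
  moreover have "(\<Sum>p\<in>B. coeff_cd (W2 p) i j) = (\<Sum>k\<le>i. \<Sum>p\<in>P k. coeff_cd (W2 p) i j)"
    unfolding B_def
  proof (rule sum.UNION_disjoint)
    show "\<forall>k\<in>{..i}. \<forall>l\<in>{..i}. k \<noteq> l \<longrightarrow> P k \<inter> P l = {}"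
      unfolding P_def by (intro ballI impI paths_empty_hd) simp
  qed (use fin in auto)
  moreover have "\<dots> = (\<Sum>k\<le>i. coeff_cd (S k) (i - k) j)"
    unfolding coeff_cd_sum[symmetric] sum_P
    by (auto simp: coeff_cd_sum coeff_cd_c_power_mult intro!: sum.cong)
  moreover have "\<dots> = coeff_cd (Z n) i j"
    by (simp add: Z_eq_word_functional[OF word_functional_col_series] S_def coeff_cd_c_series)
  ultimately show "finite {p \<in> R2 n. coeff_cd (W2 p) i j \<noteq> 0} \<and>
      coeff_cd (Z n) i j = (\<Sum>p | p \<in> R2 n \<and> coeff_cd (W2 p) i j \<noteq> 0. coeff_cd (W2 p) i j)"
    by simp
qed

section \<open>The paths R4\<close>

text \<open>
  Suffixes at height \<open>h + 1\<close> with \<open>n\<close> remaining steps: \<open>post_sum\<close> collects those after the mark,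
  \<open>pre_sum\<close> those whose mark is still to come. In \<open>pre_sum\<close> the weight \<open>abar\<close> is attached to the
  steps from height 1 to height 2 instead of those from 2 to 1, which spares a case distinction and
  does not change the total weight of a path that starts at height 1.
\<close>

primrec post_sum :: "nat \<Rightarrow> nat \<Rightarrow> K" where
  "post_sum 0 h = (if h = 0 then 1 else 0)"
| "post_sum (Suc n) h =
     (if h = 0 then bbar * post_sum n 1 else post_sum n (h - 1) + post_sum n (Suc h))"

primrec pre_sum :: "nat \<Rightarrow> nat \<Rightarrow> K" where
  "pre_sum 0 h = (if h = 0 then 1 else 0)"
| "pre_sum (Suc n) h =
     (if h = 0 then abar * pre_sum n 1 + bbar * post_sum n 1
      else pre_sum n (h - 1) + pre_sum n (Suc h))"

text \<open>At \<open>h = 0\<close> this rearranges the recursion of \<open>pre_sum\<close>; at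
  larger \<open>h\<close> all terms obey the same unweighted recursion, so the identity
  propagates.\<close>

lemma post_sum_eq: "post_sum (Suc n) h = pre_sum (Suc n) h - abar * pre_sum n (Suc h)"
proof (induction n arbitrary: h)
  case (Suc n)
  show ?case
  proof (cases h)
    case (Suc m)
    then show ?thesis
      using Suc.IH[of m] Suc.IH[of "Suc (Suc m)"]
      by (simp only: post_sum.simps(2)[of "Suc n"] pre_sum.simps(2)[of "Suc n"])
         (simp add: algebra_simps)
  qed simp
qed auto

text \<open>Both steps between heights 1 and 2 carry \<open>kappa\<close>. Pulling one
  \<open>kappa\<close> out of all suffixes from above height 1 leaves \<open>kappa * kappa\<close>
  on the up step and 1 on the down step.\<close>

lemma height_sum_eq_pre_sum:
  fixes n
  defines "r \<equiv> height_sum at_height_1 (\<lambda>i. bidiag_weight abar bbar kappa)"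
  shows "r n s (Suc h) = (if h = 0 then 1 else kappa) * pre_sum n h"
proof -
  \<comment> \<open>Height 0 joins the induction: its only step leads back to height 1, with weight
    \<open>abar\<close>.\<close>
  have "(\<forall>s h. r n s (Suc h) = (if h = 0 then 1 else kappa) * pre_sum n h) \<and>
      (\<forall>s. r n s 0 = (if n = 0 then 0 else abar * pre_sum (n - 1) 0))"
  proof (induction n)
    case 0
    then show ?case
      by (simp add: r_def at_height_1_def)
  next
    case (Suc n)
    note IH = Suc.IH[THEN conjunct1, rule_format] Suc.IH[THEN conjunct2, rule_format]
    have r_Suc: "r (Suc n) s h = bidiag_weight abar bbar kappa h (Suc h) * r n (Suc s) (Suc h) +
        (if h = 0 then 0 else bidiag_weight abar bbar kappa h (h - 1) * r n (Suc s) (h - 1))" for s h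
      by (simp add: r_def)
    have "r (Suc n) s (Suc 0) = pre_sum (Suc n) 0" for s
    proof -
      have "r (Suc n) s (Suc 0) = (kappa * kappa) * pre_sum n 1 +
          bbar * (if n = 0 then 0 else abar * pre_sum (n - 1) 0)"
        unfolding r_Suc using IH(1)[of "Suc s" 1]
        by (simp add: IH(2) bidiag_weight_def numeral_2_eq_2)
      also have "\<dots> = pre_sum (Suc n) 0"
      proof (cases n)
        case (Suc m)
        \<comment> \<open>The recursion of \<open>pre_sum\<close> turns \<open>pre_sum m 2\<close>
          into the difference in parentheses.\<close>
        have post: "post_sum (Suc m) 1 = pre_sum (Suc m) 1 - abar * (pre_sum (Suc m) 1 - pre_sum m 0)"
          using post_sum_eq[of m 1] by simp
        have "pre_sum (Suc (Suc m)) 0 = abar * pre_sum (Suc m) 1 + bbar * post_sum (Suc m) 1"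
          by simp
        also have "\<dots> = (abar + bbar - abar * bbar) * pre_sum (Suc m) 1 + bbar * (abar * pre_sum m 0)"
          unfolding post by (simp only: algebra_simps)
        finally show ?thesis
          by (simp add: Suc abar_bbar del: pre_sum.simps)
      qed simp
      finally show ?thesis .
    qed
    moreover have "r (Suc n) s (Suc (Suc h)) = kappa * pre_sum (Suc n) (Suc h)" for s h
      unfolding r_Suc
      by (cases h) (simp_all add: IH(1) bidiag_weight_def numeral_2_eq_2 algebra_simps)
    moreover have "r (Suc n) s 0 = abar * pre_sum n 0" for s
      unfolding r_Suc by (simp add: IH(1) bidiag_weight_def)
    ultimately show ?case
      by (auto simp: gr0_conv_Suc)
  qed
  then show ?thesis
    by blast
qed

text \<open>
  The step weights for a mark at \<open>v\<^sub>k\<close>. They vanish on the steps that violate the conditions on an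
  \<open>R4\<close> path: those that reach height 0, and the \<open>k\<close>-th step if it does not end at height 1.
\<close>

definition mark_weight :: "nat \<Rightarrow> nat \<Rightarrow> nat \<Rightarrow> nat \<Rightarrow> K" where
  "mark_weight k i h h' =
     (if h' = 0 \<or> (i = k \<and> h' \<noteq> 1) then 0
      else if h = 2 \<and> h' = 1 \<and> i \<le> k then abar
      else if h = 1 \<and> h' = 2 \<and> i > k then bbar
      else 1)"

abbreviation mark_sum :: "nat \<Rightarrow> nat \<Rightarrow> nat \<Rightarrow> nat \<Rightarrow> K" where
  "mark_sum k \<equiv> height_sum at_height_1 (mark_weight k)"

lemma mark_sum_after: "k \<le> s \<Longrightarrow> mark_sum k n s (Suc h) = post_sum n h"
proof (induction n arbitrary: s h)
  case (Suc n)
  then have IH: "mark_sum k n (Suc s) (Suc h) = post_sum n h" for h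
    by simp
  have "mark_weight k (Suc s) (Suc h) (Suc (Suc h)) = (if h = 0 then bbar else 1)" for h
    using Suc.prems by (simp add: mark_weight_def)
  moreover have "mark_weight k (Suc s) (Suc h) h = (if h = 0 then 0 else 1)" for h
    using Suc.prems by (simp add: mark_weight_def)
  ultimately show ?case
    by (cases h) (simp_all add: IH)
qed (simp add: at_height_1_def)

text \<open>The term \<open>k = s\<close> marks the current vertex and is excluded by hand above
  height 1, since \<open>mark_weight\<close> tests a mark only on the step into it. Before the mark,
  a suffix from above height 1 has one more step from 2 to 1 than from 1 to 2, whence the extra
  \<open>abar\<close>.\<close>

lemma mark_sum_before:
  "(\<Sum>k=s..s+n. if k = s \<and> h \<noteq> 0 then 0 else mark_sum k n s (Suc h)) =
   (if h = 0 then 1 else abar) * pre_sum n h"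
proof (induction n arbitrary: s h)
  case 0
  then show ?case
    by (simp add: at_height_1_def)
next
  case (Suc n)
  let ?t = "\<lambda>s h k. if k = s \<and> h \<noteq> 0 then 0 else mark_sum k n s (Suc h)"
  let ?S = "{Suc s..Suc s + n}"
  have up: "mark_weight k (Suc s) (Suc h) (Suc (Suc h)) * mark_sum k n (Suc s) (Suc (Suc h))
      = ?t (Suc s) (Suc h) k" if "k \<in> ?S" for k
    using that by (auto simp: mark_weight_def)
  have down: "mark_weight k (Suc s) (Suc h) h * mark_sum k n (Suc s) h
      = (if h = 0 then 0 else if h = 1 then abar else 1) * ?t (Suc s) (h - 1) k" if "k \<in> ?S" for k
    using that by (cases h) (auto simp: mark_weight_def numeral_2_eq_2)
  have "mark_sum k (Suc n) s (Suc h) = ?t (Suc s) (Suc h) k +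
      (if h = 0 then 0 else if h = 1 then abar else 1) * ?t (Suc s) (h - 1) k" if "k \<in> ?S" for k
    using up[OF that] down[OF that] by simp
  then have "(\<Sum>k\<in>?S. mark_sum k (Suc n) s (Suc h)) = (\<Sum>k\<in>?S. ?t (Suc s) (Suc h) k) +
      (if h = 0 then 0 else if h = 1 then abar else 1) * (\<Sum>k\<in>?S. ?t (Suc s) (h - 1) k)"
    by (simp only: sum.distrib sum_distrib_left cong: sum.cong)
  also have "\<dots> = abar * pre_sum n (Suc h) +
      (if h = 0 then 0 else abar * pre_sum n (h - 1))"
    unfolding Suc.IH by auto
  finally have S: "(\<Sum>k\<in>?S. mark_sum k (Suc n) s (Suc h)) = abar * pre_sum n (Suc h) +
      (if h = 0 then 0 else abar * pre_sum n (h - 1))" .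
  \<comment> \<open>If the current vertex is the marked one, all remaining steps come after the
    mark; this term is split off.\<close>
  have "(\<Sum>k=s..s + Suc n. if k = s \<and> h \<noteq> 0 then 0 else mark_sum k (Suc n) s (Suc h)) =
      (if h \<noteq> 0 then 0 else mark_sum s (Suc n) s (Suc h)) +
      (\<Sum>k\<in>?S. if k = s \<and> h \<noteq> 0 then 0 else mark_sum k (Suc n) s (Suc h))"
    by (subst sum.atLeast_Suc_atMost) simp_all
  also have "(\<Sum>k\<in>?S. if k = s \<and> h \<noteq> 0 then 0 else mark_sum k (Suc n) s (Suc h)) =
      (\<Sum>k\<in>?S. mark_sum k (Suc n) s (Suc h))"
    by (rule sum.cong) auto
  also have "(if h \<noteq> 0 then 0 else mark_sum s (Suc n) s (Suc h)) =
      (if h \<noteq> 0 then 0 else post_sum (Suc n) h)"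
    by (simp only: mark_sum_after[OF order_refl])
  finally show ?case
    unfolding S by (auto simp: algebra_simps)
qed

lemma W4_eq:
  assumes p: "p \<in> R3 n" and k: "k \<le> 2 * n"
  shows "path_weight (\<lambda>v. 1) (\<lambda>v. 1) (\<lambda>i u v. mark_weight k i (snd u) (snd v)) p =
    (if (p, k) \<in> R4 n then W4 (p, k) else 0)"
proof -
  have len: "length p = 2 * n + 1" and p0: "p ! 0 = (0, 1)"
    using p by (simp_all add: R3_def paths_def)
  show ?thesis
  proof (cases "(p, k) \<in> R4 n")
    case True
    then have "snd (p ! i) > 0" if "i \<le> 2 * n" for i
      using that len by (auto simp: R4_def)
    moreover have "snd (p ! k) = 1"
      using True by (simp add: R4_def)
    ultimately have "mark_weight k i (snd (p ! (i - 1))) (snd (p ! i)) =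
        (if snd (p ! (i - 1)) = 2 \<and> snd (p ! i) = 1 \<and> i \<le> k then abar
         else if snd (p ! (i - 1)) = 1 \<and> snd (p ! i) = 2 \<and> i > k then bbar
         else 1)" if "i \<in> {1..2 * n}" for i
      using that by (auto simp: mark_weight_def)
    then show ?thesis
      using True len by (simp add: W4_def path_weight_def)
  next
    case False
    then have "(\<exists>v\<in>set p. snd v = 0) \<or> snd (p ! k) \<noteq> 1"
      using p k by (auto simp: R4_def R3_def)
    then have "(\<exists>i\<le>2 * n. snd (p ! i) = 0) \<or> snd (p ! k) \<noteq> 1"
      using len by (metis Suc_eq_plus1 in_set_conv_nth less_Suc_eq_le)
    then obtain i where i: "i \<le> 2 * n" "snd (p ! i) = 0 \<or> i = k \<and> snd (p ! i) \<noteq> 1"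
      using k by blast
    \<comment> \<open>The path starts at height 1, so index 0 violates nothing, even if the mark is
      there. The violation thus shows in a step of weight 0.\<close>
    then have "i \<in> {1..2 * n}"
      using p0 by (cases i) auto
    moreover have "mark_weight k i (snd (p ! (i - 1))) (snd (p ! i)) = 0"
      using i by (auto simp: mark_weight_def)
    ultimately have "(\<Prod>i\<in>{1..length p - 1}. mark_weight k i (snd (p ! (i - 1))) (snd (p ! i))) = 0"
      using len by (intro prod_zero) auto
    then show ?thesis
      using False by (simp add: path_weight_def)
  qed
qed

lemma sum_R4: "finite (R4 n) \<and> (\<Sum>p\<in>R4 n. W4 p) = Z n"
proof
  have sub: "R4 n \<subseteq> R3 n \<times> {0..2 * n}"
    by (auto simp: R4_def R3_def)
  have fin: "finite (R3 n \<times> {0..2 * n})"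
    using finite_R3 by simp
  show "finite (R4 n)"
    using sub fin by (rule finite_subset)
  have "(\<Sum>p\<in>R4 n. W4 p) = (\<Sum>p\<in>R3 n \<times> {0..2 * n}. if p \<in> R4 n then W4 p else 0)"
    using sub fin by (intro sum.mono_neutral_cong_left) auto
  also have "\<dots> = (\<Sum>p\<in>R3 n. \<Sum>k=0..2*n. if (p, k) \<in> R4 n then W4 (p, k) else 0)"
    unfolding sum.cartesian_product by (intro sum.cong) auto
  \<comment> \<open>For a fixed mark the weights depend only on step numbers and heights, so the
    inner sum becomes a \<open>height_sum\<close>.\<close>
  also have "\<dots> = (\<Sum>k=0..2*n. \<Sum>p\<in>R3 n. if (p, k) \<in> R4 n then W4 (p, k) else 0)"
    by (rule sum.swap)
  also have "\<dots> = (\<Sum>k=0..2*n. mark_sum k (2 * n) 0 (Suc 0))"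
  proof (rule sum.cong[OF refl])
    fix k assume "k \<in> {0..2*n}"
    then have "(\<Sum>p\<in>R3 n. if (p, k) \<in> R4 n then W4 (p, k) else 0) =
        (\<Sum>p\<in>R3 n. path_weight (\<lambda>v. 1) (\<lambda>v. 1) (\<lambda>i u v. mark_weight k i (snd u) (snd v)) p)"
      by (intro sum.cong) (simp_all add: W4_eq)
    also have "\<dots> = mark_sum k (2 * n) 0 (Suc 0)"
      unfolding sum_paths_height_1 by simp
    finally show "(\<Sum>p\<in>R3 n. if (p, k) \<in> R4 n then W4 (p, k) else 0) = mark_sum k (2 * n) 0 (Suc 0)" .
  qed
  also have "\<dots> = pre_sum (2 * n) 0"
    using mark_sum_before[where s = 0 and n = "2 * n" and h = 0] by simp
  also have "\<dots> = Z n"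
    by (simp add: Z_eq_height_sum height_sum_eq_pre_sum)
  finally show "(\<Sum>p\<in>R4 n. W4 p) = Z n" .
qed

section \<open>The paths R1\<close>

text \<open>Suffixes of an \<open>R1\<close> path with \<open>2 n\<close> remaining steps, starting at height \<open>2 j + 1\<close>.\<close>

primrec jump_sum :: "nat \<Rightarrow> nat \<Rightarrow> K" where
  "jump_sum 0 j = (if j = 0 then 1 else 0)"
| "jump_sum (Suc n) j = (if j = 0 then bbar else 1) * (\<Sum>i=j-1..n. jump_sum n i)"

text \<open>Exchanging the sums over \<open>l \<le> i\<close> lets the first jump and the descent
  after it act on the row \<open>r\<close>, as \<open>D\<close> and then \<open>E\<close>. The bound
  \<open>n\<close> is exact: from above height \<open>2 * n + 1\<close>, height 1 is out of reach in
  \<open>2 * n\<close> steps.\<close>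

lemma sum_jump_sum:
  "(\<Sum>j\<le>n. r j * jump_sum n j) = fold row_act (concat (replicate n [LetD, LetE])) r 0"
proof (induction n arbitrary: r)
  case (Suc n)
  have "(\<Sum>l\<le>n. \<Sum>i=l..n. r (Suc l) * jump_sum n i)
      = (\<Sum>l\<le>n. \<Sum>i\<in>{i \<in> {..n}. l \<le> i}. r (Suc l) * jump_sum n i)"
    by (intro sum.cong) auto
  also have "\<dots> = (\<Sum>i\<le>n. \<Sum>l\<in>{l \<in> {..n}. l \<le> i}. r (Suc l) * jump_sum n i)"
    by (rule sum.swap_restrict) auto
  also have "\<dots> = (\<Sum>i\<le>n. (\<Sum>l\<le>i. r (Suc l)) * jump_sum n i)"
    unfolding sum_distrib_right by (intro sum.cong) auto
  finally have swap: "(\<Sum>l\<le>n. \<Sum>i=l..n. r (Suc l) * jump_sum n i) =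
      (\<Sum>i\<le>n. (\<Sum>l\<le>i. r (Suc l)) * jump_sum n i)" .
  have "(\<Sum>j\<le>Suc n. r j * jump_sum (Suc n) j) =
      bbar * r 0 * (\<Sum>i\<le>n. jump_sum n i) + (\<Sum>l\<le>n. \<Sum>i=l..n. r (Suc l) * jump_sum n i)"
    by (simp add: sum.atMost_Suc_shift sum_distrib_left atLeast0AtMost mult_ac del: sum.atMost_Suc)
  also have "\<dots> = (\<Sum>i\<le>n. (bbar * r 0 + (\<Sum>l\<le>i. r (Suc l))) * jump_sum n i)"
    by (simp add: swap distrib_right sum.distrib sum_distrib_left)
  also have "\<dots> = (\<Sum>i\<le>n. row_act LetE (row_act LetD r) i * jump_sum n i)"
    by (simp add: sum.shift_bounds_cl_Suc_ivl atLeast0AtMost del: sum.cl_ivl_Suc)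
  finally show ?case
    by (simp add: Suc.IH del: row_act.simps)
qed simp

definition R1_steps :: "nat \<Rightarrow> (int \<times> int) set" where
  "R1_steps i = (if even i then {(1, -1)} else {(1, 2 * int k - 1) | k :: nat. True})"

definition R1_weight :: "nat \<Rightarrow> vertex \<Rightarrow> vertex \<Rightarrow> K" where
  "R1_weight i u v =
     (if odd i \<and> u = (int i - 1, 1) \<and> (\<exists>k'. v = (int i, 2 * k' + 2)) then bbar else 1)"

lemma R1_steps_snd: "a \<in> R1_steps i \<Longrightarrow> snd a \<ge> -1"
  by (auto simp: R1_steps_def split: if_splits)

lemma R1_paths_empty:
  assumes "h > n + 1"
  shows "paths (\<lambda>i. R1_steps (i + s)) {(x, h)} {(y, 1)} n = {}"
  using paths_height_le[of _ "\<lambda>i. R1_steps (i + s)" "(x, h)" "{(y, 1)}" n] R1_steps_snd assms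
  by fastforce

text \<open>An even target height is 0, which only \<open>j = 0\<close> permits, or of the form
  \<open>2 * i + 2\<close>. Truncation in \<open>j - 1\<close> gives \<open>j = 0\<close> and
  \<open>j = 1\<close> the same range of \<open>i\<close>.\<close>

lemma R1_displacement_odd:
  "displacement (x, 2 * j + 1) v \<in> R1_steps (Suc (2 * m)) \<longleftrightarrow>
     v = (x + 1, 0) \<and> j = 0 \<or> (\<exists>i\<ge>j - 1. v = (x + 1, 2 * i + 2))"
proof
  assume "displacement (x, 2 * j + 1) v \<in> R1_steps (Suc (2 * m))"
  then obtain k where "fst v = x + 1" "int (snd v) - 2 * int j = 2 * int k"
    by (auto simp: displacement_def R1_steps_def)
  moreover have "int (snd v) = int (2 * (j + k))"
    using calculation by simp
  ultimately have k: "fst v = x + 1" "snd v = 2 * (j + k)"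
    by (simp_all only: of_nat_eq_iff)
  show "v = (x + 1, 0) \<and> j = 0 \<or> (\<exists>i\<ge>j - 1. v = (x + 1, 2 * i + 2))"
  proof (cases "j + k")
    case 0
    then show ?thesis
      using k by (simp add: prod_eq_iff)
  next
    case (Suc i)
    then show ?thesis
      using k by (intro disjI2 exI[of _ i]) (auto simp: prod_eq_iff)
  qed
next
  have "\<exists>k. int (2 * i + 2) - int (2 * j + 1) = 2 * int k - 1" if "j - 1 \<le> i" for i
    using that by (intro exI[of _ "i + 1 - j"]) auto
  then show "displacement (x, 2 * j + 1) v \<in> R1_steps (Suc (2 * m))"
    if "v = (x + 1, 0) \<and> j = 0 \<or> (\<exists>i\<ge>j - 1. v = (x + 1, 2 * i + 2))"
    using that by (fastforce simp: displacement_def R1_steps_def)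
qed

lemma R1_displacement_even:
  "displacement (x, h) v \<in> R1_steps (Suc (Suc (2 * m))) \<longleftrightarrow> h > 0 \<and> v = (x + 1, h - 1)"
  by (cases v) (auto simp: displacement_def R1_steps_def)

text \<open>Steps are taken in pairs: a jump to height \<open>2 * i + 2\<close> and the forced
  descent to \<open>2 * i + 1\<close>. The shift by \<open>2 * m\<close> preserves the parity on
  which the step sets depend.\<close>

lemma path_sum_R1:
  defines "P \<equiv> \<lambda>n m j. paths (\<lambda>i. R1_steps (i + 2 * m))
      {(2 * int m, 2 * j + 1)} {(2 * int (m + n), 1)} (2 * n)"
  shows "finite (P n m j) \<and>
    path_sum (\<lambda>i. R1_steps (i + 2 * m)) {(2 * int (m + n), 1)} (\<lambda>v. 1)
      (\<lambda>i. R1_weight (i + 2 * m)) (2 * n) (2 * int m, 2 * j + 1) = jump_sum n j"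
  unfolding P_def
proof (induction n arbitrary: m j)
  case 0
  then show ?case
    by (simp add: path_sum_0 paths_0)
next
  case (Suc n)
  define x where "x = 2 * int m"
  define ends :: "vertex set" where "ends = {(2 * int (m + Suc n), 1)}"
  define steps where "steps l = (\<lambda>i. R1_steps (i + 2 * m + l))" for l
  define w where "w l = (\<lambda>i. R1_weight (i + 2 * m + l))" for l
  have shift: "(\<lambda>i. steps 0 (Suc i)) = steps 1" "(\<lambda>i. w 0 (Suc i)) = w 1"
    "(\<lambda>i. steps 1 (Suc i)) = steps 2" "(\<lambda>i. w 1 (Suc i)) = w 2"
    by (simp_all add: steps_def w_def)
  have IH: "finite (paths (steps 2) {(x + 2, 2 * i + 1)} ends (2 * n))"
    "path_sum (steps 2) ends (\<lambda>v. 1) (w 2) (2 * n) (x + 2, 2 * i + 1) = jump_sum n i" for i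
    using Suc.IH[of "Suc m" i]
    by (simp_all add: steps_def w_def x_def ends_def algebra_simps)
  have even_step: "displacement (x + 1, 2 * i + 2) v \<in> steps 1 1 \<longleftrightarrow> v \<in> {(x + 2, 2 * i + 1)}" for i v
    using R1_displacement_even[of "x + 1" "2 * i + 2" v m] by (simp add: steps_def add.commute)
  note even = path_sum_Suc[of "{(x + 2, 2 * i + 1)}" "(x + 1, 2 * i + 2)" "steps 1" ends "2 * n" for i,
      unfolded even_step shift]
  have fin1: "finite (paths (steps 1) {(x + 1, 2 * i + 2)} ends (Suc (2 * n)))" for i
    by (rule even(1)) (use IH(1) in auto)
  have "path_sum (steps 1) ends (\<lambda>v. 1) (w 1) (Suc (2 * n)) (x + 1, 2 * i + 2)
      = (\<Sum>v'\<in>{(x + 2, 2 * i + 1)}. w 1 1 (x + 1, 2 * i + 2) v' *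
          path_sum (steps 2) ends (\<lambda>v. 1) (w 2) (2 * n) v')" for i
    unfolding shift(4)[symmetric] by (rule even(2)) (use IH(1) in auto)
  then have sum1: "path_sum (steps 1) ends (\<lambda>v. 1) (w 1) (Suc (2 * n)) (x + 1, 2 * i + 2)
      = jump_sum n i" for i
    using IH(2)[of i] by (simp add: w_def R1_weight_def numeral_2_eq_2)
  \<comment> \<open>Landing above height \<open>2 * n + 2\<close> leaves too few steps for the
    descent, hence the cut-off at \<open>n\<close>; landing at height 0 is a dead end, as the next
    step must go down.\<close>
  define N where "N = (\<lambda>i. (x + 1, 2 * i + 2)) ` {j - 1..n}"
  have N_iff: "(x + 1, 2 * i + 2) \<in> N \<longleftrightarrow> i \<in> {j - 1..n}" for i
    by (auto simp: N_def)
  have odd_step: "displacement (x, 2 * j + 1) v \<in> steps 0 1 \<longleftrightarrow>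
      v = (x + 1, 0) \<and> j = 0 \<or> (\<exists>i\<ge>j - 1. v = (x + 1, 2 * i + 2))" for v
    using R1_displacement_odd[of x j v m] by (simp add: steps_def)
  have N_step: "displacement (x, 2 * j + 1) v \<in> steps 0 1" if "v \<in> N" for v
    using that unfolding odd_step N_def by auto
  have empty: "paths (steps 1) {v} ends (Suc (2 * n)) = {}"
    if v: "displacement (x, 2 * j + 1) v \<in> steps 0 1" "v \<notin> N" for v
  proof -
    consider "v = (x + 1, 0)" | i where "i > n" "v = (x + 1, 2 * i + 2)"
      using v N_iff unfolding odd_step by (metis atLeastAtMost_iff not_le)
    then show ?thesis
    proof cases
      case 1
      have "displacement (x + 1, 0) v' \<notin> steps 1 1" for v'
        using R1_displacement_even[of "x + 1" 0 v' m] by (simp add: steps_def)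
      then show ?thesis
        unfolding paths_Suc 1 by simp
    next
      case 2
      then show ?thesis
        using R1_paths_empty[of "Suc (2 * n)" "2 * i + 2" "2 * m + 1"]
        by (simp add: steps_def ends_def add.assoc)
    qed
  qed
  have fin: "finite (paths (steps 1) {v} ends (Suc (2 * n)))" if "v \<in> N" for v
    using fin1 that by (auto simp: N_def)
  have finN: "finite N"
    by (simp add: N_def)
  note odd = path_sum_Suc[of N "(x, 2 * j + 1)" "steps 0" ends "Suc (2 * n)", unfolded shift,
      OF finN N_step fin empty]
  have "path_sum (steps 0) ends (\<lambda>v. 1) (w 0) (Suc (Suc (2 * n))) (x, 2 * j + 1)
      = (\<Sum>v'\<in>N. w 0 1 (x, 2 * j + 1) v' *
          path_sum (steps 1) ends (\<lambda>v. 1) (w 1) (Suc (2 * n)) v')"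
    unfolding shift(2)[symmetric] by (rule odd(2))
  also have "\<dots> = (\<Sum>i=j-1..n. w 0 1 (x, 2 * j + 1) (x + 1, 2 * i + 2) * jump_sum n i)"
    unfolding N_def by (subst sum.reindex) (simp_all only: inj_on_def o_def sum1, simp)
  also have "\<dots> = jump_sum (Suc n) j"
    by (auto simp: w_def R1_weight_def x_def sum_distrib_left intro!: sum.cong)
  finally show ?case
    using odd(1) by (simp add: steps_def w_def x_def ends_def)
qed

lemma sum_R1: "finite (R1 n) \<and> (\<Sum>p\<in>R1 n. W1 p) = Z n"
proof
  define P where "P k = paths R1_steps {(0, 2 * k + 1)} {(2 * int n, 1)} (2 * n)" for k :: nat
  have P: "finite (P k)"
    "path_sum R1_steps {(2 * int n, 1)} (\<lambda>v. 1) R1_weight (2 * n) (0, 2 * k + 1) = jump_sum n k" for k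
    using path_sum_R1[of 0 k n] by (simp_all add: P_def)
  have "R1 n = (\<Union>k. P k)"
    unfolding P_def paths_Union[symmetric] R1_def R1_steps_def[abs_def] by (rule arg_cong3) auto
  \<comment> \<open>A start above height \<open>2 * n + 1\<close> is too high to descend to 1 in
    \<open>2 * n\<close> steps.\<close>
  also have "\<dots> = (\<Union>k\<le>n. P k)"
  proof -
    have "P k = {}" if "k > n" for k
      unfolding P_def using R1_paths_empty[of "2 * n" "2 * k + 1" 0 0 "2 * int n"] that by simp
    then show ?thesis
      by (force simp: not_le[symmetric])
  qed
  finally have R1: "R1 n = (\<Union>k\<le>n. P k)" .
  show "finite (R1 n)"
    unfolding R1 using P by simp
  have "(\<Sum>p\<in>R1 n. W1 p) = (\<Sum>k\<le>n. \<Sum>p\<in>P k. W1 p)"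
    unfolding R1
  proof (rule sum.UNION_disjoint)
    show "\<forall>k\<in>{..n}. \<forall>l\<in>{..n}. k \<noteq> l \<longrightarrow> P k \<inter> P l = {}"
      unfolding P_def by (intro ballI impI paths_empty_hd) simp
  qed (use P in auto)
  also have "\<dots> = (\<Sum>k\<le>n. abar ^ k * jump_sum n k)"
    unfolding W1_def P_def R1_weight_def[symmetric] sum_path_weight_eq P(2) by simp
  also have "\<dots> = Z n"
    by (simp add: sum_jump_sum Z_eq_word_functional[OF word_functional_row] row_functional_def)
  finally show "(\<Sum>p\<in>R1 n. W1 p) = Z n" .
qed

theorem theorem3:
  fixes L :: nat
  assumes "L \<ge> 1"
  shows "finite (R1 L) \<and> Z L = (\<Sum>p\<in>R1 L. W1 p) \<and>
         infinite (R2 L) \<and> fps_sums_on W2 (R2 L) (Z L) \<and>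
         finite (R3 L) \<and> Z L = (\<Sum>p\<in>R3 L. W3 p) \<and>
         finite (R4 L) \<and> Z L = (\<Sum>p\<in>R4 L. W4 p)"
  using sum_R1 infinite_R2 fps_sums_on_R2 finite_R3 sum_R3 Z_eq_height_sum sum_R4 by simp

end
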